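(* Let $\kappa<\lambda$ be infinite cardinals. Assume that $2^{\kappa}=\kappa^+$ and that there is a cofinal, locally small family $\mathcal A\subseteq[\lambda]^{\kappa}$. Then there is a permutation group $G$ on $\lambda$ which is $\kappa$-homogeneous but not $\kappa$-transitive.
   Context: A permutation group on a set $A$ is a subgroup of the group $S(A)$ of all permutations of $A$. For a cardinal $\kappa$, $[A]^{\kappa}$ (resp. $[A]^{\le\kappa}$) is the set of subsets of $A$ of cardinality $\kappa$ (resp. at most $\kappa$). Functions are identified with their graphs. A permutation group $G$ on $A$ is $\kappa$-homogeneous iff for all $X,Y\in[A]^{\kappa}$ with $|A\setminus X|=|A\setminus Y|=|A|$ there is $g\in G$ with $g[X]=Y$. A permutation group $G$ on $A$ is $\kappa$-transitive iff for any injective function $f$ with $\operatorname{dom}(f)\cup\operatorname{ran}(f)\in[A]^{\le\kappa}$ and $|A\setminus\operatorname{dom}(f)|=|A\setminus\operatorname{ran}(f)|=|A|$ there is $g\in G$ with $f\subseteq g$. For $\kappa<\lambda$, a family $\mathcal A\subseteq[\lambda]^{\kappa}$ is cofinal iff every element of $[\lambda]^{\kappa}$ is contained in some element of $\mathcal A$. A cofinal family $\mathcal A\subseteq[\lambda]^{\kappa}$ is locally small iff $|\{A'\cap A: A'\in\mathcal A\}|\le\kappa$ for all $A\in\mathcal A$. *)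

theory Defs
  imports "HOL-Algebra.Bij"
begin

unbundle cardinal_syntax

text \<open>
  A cardinal is a relation \<open>r\<close> with \<^term>\<open>Card_order r\<close>. The cardinal \<open>r\<close>, regarded as a set
  (the set of ordinals below it), is \<^term>\<open>Field r\<close>.
\<close>

definition subsets_of_card :: "'a set \<Rightarrow> 'k rel \<Rightarrow> 'a set set"  where
  "subsets_of_card A \<kappa> = {X. X \<subseteq> A \<and> |X| =o \<kappa>}"

definition subsets_of_card_le :: "'a set \<Rightarrow> 'k rel \<Rightarrow> 'a set set"  where
  "subsets_of_card_le A \<kappa> = {X. X \<subseteq> A \<and> |X| \<le>o \<kappa>}"

text \<open>
  The elements of \<^term>\<open>carrier (BijGroup A)\<close> are the bijections of \<open>A\<close> onto itself, normalised to
  be \<^term>\<open>undefined\<close> outside \<open>A\<close>.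
\<close>

definition permutation_group :: "'a set \<Rightarrow> ('a \<Rightarrow> 'a) set \<Rightarrow> bool" where
  "permutation_group A G \<longleftrightarrow> subgroup G (BijGroup A)"

definition homogeneous :: "'k rel \<Rightarrow> 'a set \<Rightarrow> ('a \<Rightarrow> 'a) set \<Rightarrow> bool" where
  "homogeneous \<kappa> A G \<longleftrightarrow>
     (\<forall>X\<in>subsets_of_card A \<kappa>. \<forall>Y\<in>subsets_of_card A \<kappa>.
        |A - X| =o |A| \<and> |A - Y| =o |A| \<longrightarrow> (\<exists>g\<in>G. g ` X = Y))"

text \<open>
  The injective function \<open>f\<close> is partial on \<open>A\<close>, hence a map; the set
  \<open>(\<lambda>x. (x, g x)) ` A\<close> is the graph of the permutation \<open>g\<close> of \<open>A\<close>.
\<close>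

definition transitive :: "'k rel \<Rightarrow> 'a set \<Rightarrow> ('a \<Rightarrow> 'a) set \<Rightarrow> bool" where
  "transitive \<kappa> A G \<longleftrightarrow>
     (\<forall>f :: 'a \<rightharpoonup> 'a.
        inj_on f (dom f) \<and> dom f \<union> ran f \<in> subsets_of_card_le A \<kappa> \<and>
        |A - dom f| =o |A| \<and> |A - ran f| =o |A| \<longrightarrow>
        (\<exists>g\<in>G. Map.graph f \<subseteq> (\<lambda>x. (x, g x)) ` A))"

definition cofinal_family :: "'k rel \<Rightarrow> 'a set \<Rightarrow> 'a set set \<Rightarrow> bool" where
  "cofinal_family \<kappa> L \<A> \<longleftrightarrow>
     \<A> \<subseteq> subsets_of_card L \<kappa> \<and> (\<forall>X\<in>subsets_of_card L \<kappa>. \<exists>B\<in>\<A>. X \<subseteq> B)"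

definition locally_small :: "'k rel \<Rightarrow> 'a set set \<Rightarrow> bool" where
  "locally_small \<kappa> \<A> \<longleftrightarrow> (\<forall>B\<in>\<A>. |{B' \<inter> B | B'. B' \<in> \<A>}| \<le>o \<kappa>)"

end

theory Submission
  imports Defs "HOL-Algebra.Free_Abelian_Groups"
begin

text \<open>
  Close \<open>\<A>\<close> under finite intersections to get \<open>\<C>\<close>, and let the partial isomorphisms be the
  order isomorphisms between members of \<open>\<C>\<close> that also match the traces of \<open>\<C>\<close>. They compose, and
  since \<open>\<mu>\<close> is a well-order and \<open>\<A>\<close> is locally small there are at most \<open>\<kappa>\<close> of them between two
  given members of \<open>\<C>\<close>. Up to such isomorphisms there are at most \<open>2\<^sup>\<kappa> = \<kappa>\<^sup>+\<close> triples \<open>(A, X, Y)\<close> with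
  \<open>A \<in> \<A>\<close> and \<open>X, Y\<close> subsets of \<open>A\<close>. By recursion of length \<open>\<kappa>\<^sup>+\<close> choose, for one triple of each type, a
  permutation of \<open>A\<close> mapping \<open>X\<close> onto \<open>Y\<close>, generically over the at most \<open>\<kappa>\<close> maps that matter so
  far, so that a fixed partial injection \<open>\<Phi>\<close> of size \<open>\<kappa>\<close> stays uncovered: for every finite set of
  chosen maps and isomorphisms and every \<open>n\<close>, there are \<open>\<kappa>\<close> many \<open>(x, y) \<in> \<Phi>\<close> such that \<open>y\<close> is not
  reachable from \<open>x\<close> in \<open>n\<close> steps. Then the group of all permutations each of which moves every
  point along a path of bounded length, using finitely many of these maps, is homogeneous, and no
  element of it extends \<open>\<Phi>\<close>.
\<close>

section \<open>Cardinal arithmetic and transfinite choice\<close>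

text \<open>Recursion along the cardinal well-order of \<open>T\<close>: the indices before a given
  one form a set of smaller cardinality, so \<open>ext\<close> only ever meets small
  \<open>U\<close>. Finite character (\<open>fin\<close>) carries \<open>Good\<close> through
  limits, and \<open>cong\<close> says that only the values already chosen matter.\<close>

lemma transfinite_choice:
  fixes Good :: "('t \<Rightarrow> 'v) \<Rightarrow> 't set \<Rightarrow> bool"
  assumes cong: "\<And>s s' U. (\<And>t. t \<in> U \<Longrightarrow> s t = s' t) \<Longrightarrow> Good s U \<Longrightarrow> Good s' U"
    and mono: "\<And>s U F. Good s U \<Longrightarrow> F \<subseteq> U \<Longrightarrow> Good s F"
    and empty: "\<And>s. Good s {}"
    and fin: "\<And>s U. U \<subseteq> T \<Longrightarrow> (\<And>F. finite F \<Longrightarrow> F \<subseteq> U \<Longrightarrow> Good s F) \<Longrightarrow> Good s U"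
    and ext: "\<And>s U t. U \<subseteq> T \<Longrightarrow> |U| <o |T| \<Longrightarrow> t \<in> T - U \<Longrightarrow> Good s U \<Longrightarrow>
      \<exists>v. Good (s(t := v)) (insert t U)"
  shows "\<exists>s. Good s T"
proof -
  let ?r = "|T|"
  have wo: "Well_order ?r" and fld: "Field ?r = T"
    by (rule card_of_Well_order, rule Field_card_of)
  have W: "wo_rel ?r" by (rule wo_rel.intro[OF wo])
  have tr: "trans (?r - Id)"
    by (rule trans_diff_Id[OF wo_rel.TRANS[OF W] wo_rel.ANTISYM[OF W]])
  define under where "under t = underS ?r t" for t
  have under_sub: "under t \<subseteq> T" for t
    using underS_Field[of _ ?r t] fld by (auto simp: under_def)
  have R: "(y, x) \<in> ?r - Id \<longleftrightarrow> y \<in> under x" for x y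
    by (auto simp: under_def underS_def)
  have under_trans: "z \<in> under x" if "z \<in> under y" "y \<in> under x" for x y z
    using transD[OF tr, of z y x] that unfolding R by blast
  \<comment> \<open>A nonempty finite subset of \<open>U\<close> lies in
    \<open>insert m (under m)\<close> for its greatest element \<open>m\<close>; finite character
    then yields all of \<open>U\<close>, with no split into successors and limits.\<close>
  have step: "Good s U" if U: "U \<subseteq> T" and "\<And>x. x \<in> U \<Longrightarrow> Good s (insert x (under x))"
    and down: "\<And>x y. x \<in> U \<Longrightarrow> y \<in> under x \<Longrightarrow> y \<in> U" for s U
  proof (rule fin[OF U])
    fix F assume F: "finite F" "F \<subseteq> U"
    show "Good s F"
    proof (cases "F = {}")
      case False
      have "\<exists>m\<in>F. \<forall>x\<in>F. x \<in> insert m (under m)"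
        using F(1) False F(2)
      proof (induction F rule: finite_ne_induct)
        case (insert x F)
        then obtain m where m: "m \<in> F" "\<forall>y\<in>F. y \<in> insert m (under m)" by auto
        have "m \<in> T" "x \<in> T" using m insert.prems U by auto
        then consider "x \<in> insert m (under m)" | "m \<in> under x"
          using wo_rel.TOTALS[OF W] fld R by auto
        then show ?case
        proof cases
          case 1 then show ?thesis using m by auto
        next
          case 2
          have "y \<in> under x" if "y \<in> F" for y
          proof (cases "y = m")
            case False
            then have "y \<in> under m" using m(2) that by auto
            then show ?thesis using under_trans 2 by simp
          qed (use 2 in simp)
          then show ?thesis by auto
        qed
      qed auto
      then obtain m where "m \<in> F" "F \<subseteq> insert m (under m)" by blast
      with that(2)[of m] F(2) show ?thesis using mono by blast
    qed (simp add: empty)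
  qed
  \<comment> \<open>The recursion ranges over the whole type, so the guard \<open>x \<in> T\<close>
    makes the demand trivial elsewhere.\<close>
  let ?P = "\<lambda>s x v. x \<in> T \<longrightarrow> Good (s(x := v)) (insert x (under x))"
  have "\<exists>s. \<forall>x. ?P s x (s x)"
  proof (rule dependent_wf_choice[OF wo_rel.WF[OF W], where P = ?P])
    fix f g :: "'t \<Rightarrow> 'v" and x r
    assume "\<And>z. (z, x) \<in> ?r - Id \<Longrightarrow> f z = g z"
    then have "f z = g z" if "z \<in> under x" for z using that R by blast
    then have *: "(f(x := r)) z = (g(x := r)) z" if "z \<in> insert x (under x)" for z
      using that by auto
    show "(x \<in> T \<longrightarrow> Good (f(x := r)) (insert x (under x))) =
          (x \<in> T \<longrightarrow> Good (g(x := r)) (insert x (under x)))"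
    proof -
      have "Good (f(x := r)) (insert x (under x)) \<Longrightarrow> Good (g(x := r)) (insert x (under x))"
        by (rule cong[OF *])
      moreover have "Good (g(x := r)) (insert x (under x)) \<Longrightarrow> Good (f(x := r)) (insert x (under x))"
        by (rule cong[OF *[symmetric]])
      ultimately show ?thesis by argo
    qed
  next
    fix x s
    assume IH: "\<And>y. (y, x) \<in> ?r - Id \<Longrightarrow> ?P s y (s y)"
    show "\<exists>v. x \<in> T \<longrightarrow> Good (s(x := v)) (insert x (under x))"
    proof (cases "x \<in> T")
      case True
      have "Good s (under x)"
      proof (rule step[OF under_sub])
        show "Good s (insert y (under y))" if "y \<in> under x" for y
          using IH[of y] that R under_sub by auto
        show "z \<in> under x" if "y \<in> under x" "z \<in> under y" for y z
          using that under_trans by blast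
      qed
      moreover have "|under x| <o |T|"
        unfolding under_def using card_of_underS[OF card_of_Card_order, of x T] True fld by auto
      moreover have "x \<notin> under x" by (auto simp: under_def underS_def)
      ultimately show ?thesis using ext[OF under_sub, of x x s] True by simp
    qed auto
  qed
  then obtain s where s: "\<forall>x. x \<in> T \<longrightarrow> Good s (insert x (under x))" by auto
  have "Good s T"
  proof (rule step)
    show "z \<in> T" if "z \<in> under y" for y z using that under_sub by auto
  qed (use s in auto)
  then show ?thesis by blast
qed

section \<open>Sets of size below, or at most, an infinite cardinal\<close>

lemma finite_ordLess_Cinfinite: "finite S \<Longrightarrow> Cinfinite \<kappa> \<Longrightarrow> |S| <o \<kappa>"
  by (rule Cfinite_ordLess_Cinfinite) (auto simp: cfinite_def Field_card_of card_of_Card_order)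

lemma Un_ordLess_Cinfinite: "Cinfinite \<kappa> \<Longrightarrow> |A| <o \<kappa> \<Longrightarrow> |B| <o \<kappa> \<Longrightarrow> |A \<union> B| <o \<kappa>"
  by (rule card_of_Un_ordLess_infinite_Field) (auto simp: cinfinite_def)

lemma image_ordLess: "|A| <o \<kappa> \<Longrightarrow> |f ` A| <o \<kappa>"
  by (rule ordLeq_ordLess_trans[OF card_of_image])

lemma subset_ordLess: "|A| <o \<kappa> \<Longrightarrow> B \<subseteq> A \<Longrightarrow> |B| <o \<kappa>"
  by (rule ordLeq_ordLess_trans[OF card_of_mono1])

text \<open>The union of finite pieces is finite if \<open>A\<close> is, and otherwise no larger
  than \<open>A\<close>; hence a singular \<kappa> causes no trouble.\<close>

lemma UN_finite_ordLess_Cinfinite: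
  assumes \<kappa>: "Cinfinite \<kappa>" and A: "|A| <o \<kappa>" and fin: "\<And>a. a \<in> A \<Longrightarrow> finite (B a)"
  shows "|\<Union>a\<in>A. B a| <o \<kappa>"
proof (cases "finite A")
  case True
  then show ?thesis using fin \<kappa> by (intro finite_ordLess_Cinfinite) auto
next
  case False
  have "|B a| \<le>o |A|" if "a \<in> A" for a
    by (rule ordLess_imp_ordLeq[OF finite_ordLess_infinite2[OF fin[OF that] False]])
  then have "|\<Union>a\<in>A. B a| \<le>o |A|"
    using card_of_UNION_ordLeq_infinite[OF False card_of_mono1[OF order.refl]] by blast
  with A show ?thesis using ordLeq_ordLess_trans by blast
qed

lemma Times_ordLess_Cinfinite:
  "Cinfinite \<kappa> \<Longrightarrow> |A| <o \<kappa> \<Longrightarrow> |B| <o \<kappa> \<Longrightarrow> |A \<times> B| <o \<kappa>"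
  by (rule card_of_Times_ordLess_infinite_Field) (auto simp: cinfinite_def)

lemma ordLeq_not_subset_ordLess: "\<kappa> \<le>o |A| \<Longrightarrow> |B| <o \<kappa> \<Longrightarrow> \<exists>a. a \<in> A - B"
  using subset_ordLess[of B \<kappa> A] not_ordLess_ordLeq by blast

lemma ordLeq_Diff_ordLess:
  assumes \<kappa>: "Cinfinite \<kappa>" and "\<kappa> \<le>o |A|" and "|B| <o \<kappa>"
  shows "\<kappa> \<le>o |A - B|"
proof (rule ccontr)
  assume "\<not> \<kappa> \<le>o |A - B|"
  then have "|A - B| <o \<kappa>" using \<kappa> by (simp add: Card_order_iff_ordLeq_card_of  card_order_on_well_order_on)
  then have "|(A - B) \<union> B| <o \<kappa>" using assms Un_ordLess_Cinfinite by blast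
  then have "|A| <o \<kappa>" using subset_ordLess[of _ \<kappa> A] by blast
  with assms(2) show False using not_ordLess_ordLeq by blast
qed

lemma Fpow_ordLeq_Cinfinite:
  assumes \<kappa>: "Cinfinite \<kappa>" and A: "|A| \<le>o \<kappa>"
  shows "|Fpow A| \<le>o \<kappa>"
proof (cases "finite A")
  case True
  then have "finite (Fpow A)" by (simp add: Fpow_Pow_finite)
  then show ?thesis by (rule ordLess_imp_ordLeq[OF finite_ordLess_Cinfinite[OF _ \<kappa>]])
next
  case False
  then show ?thesis by (rule ordIso_ordLeq_trans[OF card_of_Fpow_infinite A])
qed

lemma Times_ordLeq_Cinfinite:
  "Cinfinite \<kappa> \<Longrightarrow> |A| \<le>o \<kappa> \<Longrightarrow> |B| \<le>o \<kappa> \<Longrightarrow> |A \<times> B| \<le>o \<kappa>"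
  by (rule card_of_Times_ordLeq_infinite_Field) (auto simp: cinfinite_def)

lemma UN_ordLeq_Cinfinite:
  "Cinfinite \<kappa> \<Longrightarrow> |I| \<le>o \<kappa> \<Longrightarrow> (\<And>i. i \<in> I \<Longrightarrow> |A i| \<le>o \<kappa>) \<Longrightarrow> |\<Union>i\<in>I. A i| \<le>o \<kappa>"
  by (rule card_of_UNION_ordLeq_infinite_Field) (auto simp: cinfinite_def)

lemma Un_ordLeq_Cinfinite: "Cinfinite \<kappa> \<Longrightarrow> |A| \<le>o \<kappa> \<Longrightarrow> |B| \<le>o \<kappa> \<Longrightarrow> |A \<union> B| \<le>o \<kappa>"
  by (rule Un_Cinfinite_bound)

lemma image_ordLeq: "|A| \<le>o \<kappa> \<Longrightarrow> |f ` A| \<le>o \<kappa>"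
  by (rule ordLeq_transitive[OF card_of_image])

lemma subset_ordLeq: "|A| \<le>o \<kappa> \<Longrightarrow> B \<subseteq> A \<Longrightarrow> |B| \<le>o \<kappa>"
  by (rule ordLeq_transitive[OF card_of_mono1])

section \<open>Paths in finite unions of partial injections\<close>

definition one_one :: "'a rel \<Rightarrow> bool" where
  "one_one \<rho> \<longleftrightarrow> single_valued \<rho> \<and> single_valued (\<rho>\<inverse>)"

text \<open>\<open>Id\<close> makes \<open>edges L ^^ n\<close> mean "joined by at most
  \<open>n\<close> steps", so the powers increase with \<open>n\<close>; the converse allows maps to
  be traversed backwards.\<close>

definition edges :: "'a rel set \<Rightarrow> 'a rel" where
  "edges L = Id \<union> \<Union>L \<union> (\<Union>L)\<inverse>"

text \<open>Asking for \<kappa> many unjoined pairs, rather than one, leaves a choice after fewer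
  than \<kappa> of them have been used or spoiled.\<close>

definition evades :: "'k rel \<Rightarrow> 'a rel \<Rightarrow> 'a rel set \<Rightarrow> bool" where
  "evades \<kappa> \<Phi> N \<longleftrightarrow> (\<forall>L n. finite L \<longrightarrow> L \<subseteq> N \<longrightarrow> \<kappa> \<le>o |\<Phi> - edges L ^^ n| )"

lemma sym_edges: "sym (edges L)"
  unfolding edges_def sym_def by auto

lemma Id_subset_edges: "Id \<subseteq> edges L"
  unfolding edges_def by auto

lemma edges_mono: "L \<subseteq> L' \<Longrightarrow> edges L \<subseteq> edges L'"
  unfolding edges_def by auto

lemma edges_insert: "edges (insert q L) = edges L \<union> q \<union> q\<inverse>"
  unfolding edges_def by auto

lemma sym_relpow: "sym E \<Longrightarrow> (x, y) \<in> E ^^ n \<Longrightarrow> (y, x) \<in> E ^^ n"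
proof (induction n arbitrary: x y)
  case (Suc n)
  then obtain z where "(x, z) \<in> E ^^ n" "(z, y) \<in> E" by auto
  with Suc have "(y, z) \<in> E" "(z, x) \<in> E ^^ n" by (auto dest: symD)
  then show ?case by (rule relpow_Suc_I2)
qed auto

lemma relpow_mono_reflexive:
  assumes "Id \<subseteq> E'" "E \<subseteq> E'" "k \<le> m" shows "E ^^ k \<subseteq> E' ^^ m"
proof -
  have "E ^^ k \<subseteq> E' ^^ k" by (induction k) (use assms(2) in auto)
  moreover have "E' ^^ k \<subseteq> E' ^^ m"
    using assms(3) by (induction m rule: dec_induct) (use assms(1) in auto)
  ultimately show ?thesis by auto
qed

lemma edges_relpow_mono: "L \<subseteq> L' \<Longrightarrow> k \<le> m \<Longrightarrow> edges L ^^ k \<subseteq> edges L' ^^ m"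
  by (intro relpow_mono_reflexive Id_subset_edges edges_mono)

lemma finite_Image_one_one: "one_one \<rho> \<Longrightarrow> finite S \<Longrightarrow> finite (\<rho> `` S) \<and> finite (\<rho>\<inverse> `` S)"
proof -
  have *: "finite (\<rho> `` S)" if "single_valued \<rho>" "finite S" for \<rho> :: "'a rel"
  proof (rule finite_subset)
    show "\<rho> `` S \<subseteq> (\<lambda>x. THE y. (x, y) \<in> \<rho>) ` S"
    proof
      fix y assume "y \<in> \<rho> `` S"
      then obtain x where "x \<in> S" "(x, y) \<in> \<rho>" by auto
      moreover then have "(THE y. (x, y) \<in> \<rho>) = y" using that(1) by (auto dest: single_valuedD)
      ultimately show "y \<in> (\<lambda>x. THE y. (x, y) \<in> \<rho>) ` S" by auto
    qed
  qed (use that in auto)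
  show "one_one \<rho> \<Longrightarrow> finite S \<Longrightarrow> finite (\<rho> `` S) \<and> finite (\<rho>\<inverse> `` S)"
    unfolding one_one_def using * by auto
qed

text \<open>Finitely many partial injections form a graph of finite degree, so balls of finite
  radius around finite sets are finite.\<close>

lemma finite_edges_relpow_Image:
  assumes "finite L" "\<And>\<rho>. \<rho> \<in> L \<Longrightarrow> one_one \<rho>" "finite S"
  shows "finite ((edges L ^^ n) `` S)"
proof (induction n)
  case (Suc n)
  have "edges L `` Z = Z \<union> (\<Union>\<rho>\<in>L. \<rho> `` Z) \<union> (\<Union>\<rho>\<in>L. \<rho>\<inverse> `` Z)" for Z
    unfolding edges_def by blast
  moreover have "(edges L ^^ Suc n) `` S = edges L `` ((edges L ^^ n) `` S)" by auto
  moreover have "finite (\<rho> `` ((edges L ^^ n) `` S))" "finite (\<rho>\<inverse> `` ((edges L ^^ n) `` S))"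
    if "\<rho> \<in> L" for \<rho>
    using finite_Image_one_one[OF assms(2)[OF that] Suc] by simp_all
  ultimately show ?case using Suc assms(1) by (metis (no_types, lifting) finite_UN finite_UnI)
qed (use assms in auto)

text \<open>A single path uses only finitely many edges of \<open>q\<close>. This is the compactness
  behind the finite character of \<open>good\<close>.\<close>

lemma finite_relpow_edges_insert:
  assumes "(x, y) \<in> edges (insert q L) ^^ n"
  shows "\<exists>q0. finite q0 \<and> q0 \<subseteq> q \<and> (x, y) \<in> edges (insert q0 L) ^^ n"
  using assms
proof (induction n arbitrary: y)
  case (Suc n)
  then obtain z where z: "(x, z) \<in> edges (insert q L) ^^ n" "(z, y) \<in> edges (insert q L)" by auto
  then obtain q0 where q0: "finite q0" "q0 \<subseteq> q" "(x, z) \<in> edges (insert q0 L) ^^ n"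
    using Suc.IH by blast
  obtain q1 where q1: "finite q1" "q1 \<subseteq> q" "(z, y) \<in> edges (insert q1 L)"
  proof (cases "(z, y) \<in> edges L")
    case True then show ?thesis using that[of "{}"] by (auto simp: edges_insert)
  next
    case False
    then show ?thesis
      using z(2) that[of "{(z, y)}"] that[of "{(y, z)}"] by (auto simp: edges_insert)
  qed
  have "edges (insert q0 L) ^^ n \<subseteq> edges (insert (q0 \<union> q1) L) ^^ n"
    by (intro relpow_mono_reflexive Id_subset_edges) (auto simp: edges_insert)
  moreover have "edges (insert q1 L) \<subseteq> edges (insert (q0 \<union> q1) L)"
    by (auto simp: edges_insert)
  ultimately have "(x, y) \<in> edges (insert (q0 \<union> q1) L) ^^ Suc n"
    using q0(3) q1(3) by auto
  then show ?case using q0 q1 by (intro exI[of _ "q0 \<union> q1"]) auto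
qed auto

text \<open>A path that uses the new edge enters at \<open>v\<close>, wanders in the \<open>E\<close>-ball of \<open>v\<close>, which misses \<open>S\<close>,
  and so can only leave through \<open>u\<close> again; hence the detour can be cut out.\<close>
lemma relpow_Un_new_edge:
  assumes E: "Id \<subseteq> E" "sym E" and q: "q \<subseteq> S \<times> S" and S: "a \<in> S" "b \<in> S" "u \<in> S"
    and fresh: "v \<notin> (E ^^ n) `` S"
    and new: "(a, b) \<notin> (E \<union> q) ^^ n"
  shows "(a, b) \<notin> (E \<union> q \<union> {(u, v), (v, u)}) ^^ n"
proof
  assume path: "(a, b) \<in> (E \<union> q \<union> {(u, v), (v, u)}) ^^ n"
  have mono: "E ^^ k \<subseteq> E ^^ m" "(E \<union> q) ^^ k \<subseteq> (E \<union> q) ^^ m" if "k \<le> m" for k m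
    by (intro relpow_mono_reflexive; use E that in auto)+
  have far: "(s, v) \<notin> E ^^ k" if "k \<le> n" "s \<in> S" for s k
    using fresh mono(1)[OF that(1)] that(2) by auto
  \<comment> \<open>Each \<open>q\<close>-edge ends in \<open>S\<close>, so after the last of them
    only \<open>E\<close>-steps separate \<open>c\<close> from \<open>S\<close>.\<close>
  have reach: "\<exists>s\<in>S. (s, c) \<in> E ^^ k" if "(a, c) \<in> (E \<union> q) ^^ k" for c k
    using that
  proof (induction k arbitrary: c)
    case (Suc k)
    then obtain d where d: "(a, d) \<in> (E \<union> q) ^^ k" "(d, c) \<in> E \<union> q" by auto
    from Suc.IH[OF d(1)] obtain s where s: "s \<in> S" "(s, d) \<in> E ^^ k" by auto
    show ?case
    proof (cases "(d, c) \<in> E")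
      case True then show ?thesis using s by auto
    next
      case False
      then have "c \<in> S" using d(2) q by auto
      moreover have "(c, c) \<in> E ^^ Suc k" using mono(1)[of 0 "Suc k"] by auto
      ultimately show ?thesis by blast
    qed
  qed (use S in auto)
  \<comment> \<open>Invariant: either the new edge can be avoided altogether, or the path is
    currently on a detour in the \<open>E\<close>-ball of \<open>v\<close> and \<open>u\<close> is
    reachable without the new edge.\<close>
  have "(a, c) \<in> (E \<union> q) ^^ k \<or> (a, u) \<in> (E \<union> q) ^^ k \<and> (v, c) \<in> E ^^ k"
    if "k \<le> n" "(a, c) \<in> (E \<union> q \<union> {(u, v), (v, u)}) ^^ k" for c k
    using that
  proof (induction k arbitrary: c)
    case (Suc k)
    then obtain d where d: "(a, d) \<in> (E \<union> q \<union> {(u, v), (v, u)}) ^^ k"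
      "(d, c) \<in> E \<union> q \<union> {(u, v), (v, u)}" by auto
    from Suc.IH[OF _ d(1)] Suc.prems
    consider "(a, d) \<in> (E \<union> q) ^^ k" | "(a, u) \<in> (E \<union> q) ^^ k" "(v, d) \<in> E ^^ k" by auto
    then show ?case
    proof cases
      case 1
      consider "(d, c) \<in> E \<union> q" | "d = u" "c = v" | "d = v" using d(2) by auto
      then show ?thesis
      proof cases
        case 2
        have "(v, v) \<in> E ^^ Suc k" using mono(1)[of 0 "Suc k"] by auto
        then show ?thesis using 1 2 mono(2)[of k "Suc k"] by auto
      next
        case 3
        then show ?thesis using reach[OF 1] far[of k] Suc.prems by auto
      qed (use 1 in auto)
    next
      case 2
      have "d \<notin> S"
      proof
        assume "d \<in> S"
        then show False using far[of k d] sym_relpow[OF E(2) 2(2)] Suc.prems by auto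
      qed
      then have "(d, c) \<in> E \<or> c = u" using d(2) q S by auto
      then show ?thesis using 2 mono(2)[of k "Suc k"] by auto
    qed
  qed auto
  then have "(v, b) \<in> E ^^ n" using path new by blast
  then show False using far[OF order.refl S(2)] sym_relpow[OF E(2)] by blast
qed

text \<open>Each promise in \<open>Pr\<close> forbids only finite \<open>edges L\<close>-balls
  around its endpoints, \<open>w\<close> and the points of \<open>Field q\<close>. Fewer than
  \<kappa> vertices are thus excluded from \<open>V\<close>. Both orientations of the new edge are
  covered, to serve \<open>Dom\<close> and \<open>Ran\<close> tasks alike.\<close>

lemma fresh_vertex:
  assumes \<kappa>: "Cinfinite \<kappa>" and q: "|q| <o \<kappa>" and Pr: "|Pr| <o \<kappa>" and V: "\<kappa> \<le>o |V|"
    and L: "\<And>L n a b. (L, n, a, b) \<in> Pr \<Longrightarrow>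
      finite L \<and> (\<forall>\<rho>\<in>L. one_one \<rho>) \<and> (a, b) \<notin> edges (insert q L) ^^ n"
  shows "\<exists>v\<in>V. v \<notin> Field q \<and> (\<forall>(L, n, a, b)\<in>Pr.
    (a, b) \<notin> edges (insert (insert (w, v) q) L) ^^ n \<and>
    (a, b) \<notin> edges (insert (insert (v, w) q) L) ^^ n)"
proof -
  have "Field q = fst ` q \<union> snd ` q" by (force simp: Field_def)
  then have fq: "|Field q| <o \<kappa>"
    using Un_ordLess_Cinfinite[OF \<kappa> image_ordLess image_ordLess] q by metis
  \<comment> \<open>The index \<open>s\<close> ranges over \<open>insert w (Field q)\<close>, which
    is nonempty even for empty \<open>q\<close>, so the balls around \<open>a\<close>,
    \<open>b\<close> and \<open>w\<close> are always included.\<close>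
  let ?ball = "\<lambda>((L, n, a, b), s). (edges L ^^ n) `` {a, b, w, s}"
  let ?B = "\<Union>z\<in>Pr \<times> insert w (Field q). ?ball z"
  have iq: "|insert w (Field q)| <o \<kappa>"
    using Un_ordLess_Cinfinite[OF \<kappa> finite_ordLess_Cinfinite[OF _ \<kappa>, of "{w}"] fq] by simp
  have "|?B| <o \<kappa>"
    by (rule UN_finite_ordLess_Cinfinite[OF \<kappa> Times_ordLess_Cinfinite[OF \<kappa> Pr iq]])
      (use L in \<open>auto intro!: finite_edges_relpow_Image\<close>)
  then have "|?B \<union> Field q| <o \<kappa>" by (rule Un_ordLess_Cinfinite[OF \<kappa> _ fq])
  from ordLeq_not_subset_ordLess[OF V this] obtain v where v: "v \<in> V" "v \<notin> ?B" "v \<notin> Field q"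
    by auto
  have "(a, b) \<notin> (edges L \<union> (q \<union> q\<inverse>) \<union> {(w, v), (v, w)}) ^^ n" if "(L, n, a, b) \<in> Pr" for L n a b
  proof (rule relpow_Un_new_edge[OF Id_subset_edges sym_edges, where S = "{a, b, w} \<union> Field q"])
    show "v \<notin> (edges L ^^ n) `` ({a, b, w} \<union> Field q)" using v(2) that by force
    show "(a, b) \<notin> (edges L \<union> (q \<union> q\<inverse>)) ^^ n" using L[OF that] by (simp add: edges_insert Un_assoc)
    have "q \<subseteq> Field q \<times> Field q" by (rule subrelI) (auto intro: FieldI1 FieldI2)
    then show "q \<union> q\<inverse> \<subseteq> ({a, b, w} \<union> Field q) \<times> ({a, b, w} \<union> Field q)" by blast
  qed simp_all
  moreover have "edges (insert (insert (w, v) q) L) = edges L \<union> (q \<union> q\<inverse>) \<union> {(w, v), (v, w)}"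
    "edges (insert (insert (v, w) q) L) = edges L \<union> (q \<union> q\<inverse>) \<union> {(w, v), (v, w)}" for L
    unfolding edges_insert by blast+
  ultimately have "\<forall>(L, n, a, b)\<in>Pr. (a, b) \<notin> edges (insert (insert (w, v) q) L) ^^ n \<and>
      (a, b) \<notin> edges (insert (insert (v, w) q) L) ^^ n"
    by (auto split: prod.splits)
  with v(1,3) show ?thesis by blast
qed

text \<open>Choose among the \<kappa> many pairs that evade \<open>L\<close> one whose source is
  more than \<open>n\<close> steps of \<open>edges L\<close> away from \<open>Field q\<close>: a
  path of length \<open>n\<close> from there never gets to use \<open>q\<close>.\<close>

lemma fresh_pair:
  assumes \<kappa>: "Cinfinite \<kappa>" and q: "|q| <o \<kappa>" and B: "|B| <o \<kappa>" and \<Phi>: "one_one \<Phi>"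
    and L: "finite L" "\<And>\<rho>. \<rho> \<in> L \<Longrightarrow> one_one \<rho>" and many: "\<kappa> \<le>o |\<Phi> - edges L ^^ n|"
  shows "\<exists>z\<in>\<Phi> - B. z \<notin> edges (insert q L) ^^ n"
proof -
  have "Field q = fst ` q \<union> snd ` q" by (force simp: Field_def)
  then have fq: "|Field q| <o \<kappa>"
    using Un_ordLess_Cinfinite[OF \<kappa> image_ordLess image_ordLess] q by metis
  let ?R = "\<Union>s\<in>Field q. (edges L ^^ n) `` {s}"
  have "|?R| <o \<kappa>"
    by (rule UN_finite_ordLess_Cinfinite[OF \<kappa> fq]) (use L in \<open>auto intro!: finite_edges_relpow_Image\<close>)
  \<comment> \<open>This set contains all pairs of \<Phi> with source in \<open>?R\<close>: as
    \<Phi> is single-valued, each source belongs to only one pair.\<close>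
  then have "|(\<lambda>x. (x, THE y. (x, y) \<in> \<Phi>)) ` ?R| <o \<kappa>" by (rule image_ordLess)
  then have "|(\<lambda>x. (x, THE y. (x, y) \<in> \<Phi>)) ` ?R \<union> B| <o \<kappa>" by (rule Un_ordLess_Cinfinite[OF \<kappa> _ B])
  from ordLeq_not_subset_ordLess[OF many this] obtain a b where
    ab: "(a, b) \<in> \<Phi>" "(a, b) \<notin> edges L ^^ n" "(a, b) \<notin> B"
      "(a, b) \<notin> (\<lambda>x. (x, THE y. (x, y) \<in> \<Phi>)) ` ?R" by auto
  have "(THE y. (a, y) \<in> \<Phi>) = b"
    using \<Phi> ab(1) unfolding one_one_def by (auto dest: single_valuedD)
  then have "a \<notin> ?R" using ab(4) by (metis (no_types, lifting) image_eqI)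
  then have far: "(a, s) \<notin> edges L ^^ n" if "s \<in> Field q" for s
    using that sym_relpow[OF sym_edges] by fastforce
  \<comment> \<open>Every vertex reached before the last step is, by induction, within
    \<open>n\<close> steps of \<open>a\<close> along \<open>edges L\<close>, hence outside
    \<open>Field q\<close>; so the next step cannot be a \<open>q\<close>-edge.\<close>
  have "(a, c) \<in> edges L ^^ k" if "k \<le> n" "(a, c) \<in> edges (insert q L) ^^ k" for k c
    using that
  proof (induction k arbitrary: c)
    case (Suc k)
    then obtain d where d: "(a, d) \<in> edges (insert q L) ^^ k" "(d, c) \<in> edges (insert q L)" by auto
    from Suc d have ad: "(a, d) \<in> edges L ^^ k" by auto
    then have "(a, d) \<in> edges L ^^ n" using edges_relpow_mono[of L L k n] Suc.prems by auto
    then have "d \<notin> Field q" using far by blast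
    then have "(d, c) \<in> edges L" using d(2) by (auto simp: edges_insert Field_def)
    with ad show ?case by auto
  qed auto
  then have "(a, b) \<notin> edges (insert q L) ^^ n" using ab(2) by blast
  with ab show ?thesis by blast
qed

section \<open>The generic step\<close>

text \<open>\<open>Dom a\<close> and \<open>Ran a\<close> put \<open>a\<close> into the domain and the range of the permutation under construction;
  \<open>Evade L n i\<close> names the \<open>i\<close>-th of \<open>\<kappa>\<close> many pairs of \<open>\<Phi>\<close> that must never become joined by a
  path of length \<open>n\<close> along \<open>L\<close> and the permutation.\<close>
datatype ('a, 'k) task = is_Dom: Dom 'a | is_Ran: Ran 'a | is_Evade: Evade "'a rel set" nat 'k

definition chosen :: "(('a, 'k) task \<Rightarrow> 'a \<times> 'a) \<Rightarrow> ('a, 'k) task set \<Rightarrow> 'a rel" where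
  "chosen s U = s ` {t \<in> U. \<not> is_Evade t}"

text \<open>Injectivity on the \<open>Evade\<close> tasks makes the indices \<open>i\<close>, for
  fixed \<open>L\<close> and \<open>n\<close>, name different pairs of \<Phi>; this is how \<kappa>
  many of them survive.\<close>

definition good :: "'a rel \<Rightarrow> 'a set \<Rightarrow> 'a set \<Rightarrow> 'a set \<Rightarrow>
    (('a, 'k) task \<Rightarrow> 'a \<times> 'a) \<Rightarrow> ('a, 'k) task set \<Rightarrow> bool" where
  "good \<Phi> A X Y s U \<longleftrightarrow>
     one_one (chosen s U) \<and> chosen s U \<subseteq> A \<times> A \<and>
     (\<forall>(x, y)\<in>chosen s U. x \<in> X \<longleftrightarrow> y \<in> Y) \<and>
     (\<forall>a. Dom a \<in> U \<longrightarrow> fst (s (Dom a)) = a) \<and>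
     (\<forall>a. Ran a \<in> U \<longrightarrow> snd (s (Ran a)) = a) \<and>
     (\<forall>t\<in>U. is_Evade t \<longrightarrow> s t \<in> \<Phi>) \<and> inj_on s {t \<in> U. is_Evade t} \<and>
     (\<forall>L n i. Evade L n i \<in> U \<longrightarrow> s (Evade L n i) \<notin> edges (insert (chosen s U) L) ^^ n)"

section \<open>Finite character of \<open>good\<close>, and extension by one task\<close>

lemma one_one_subset: "one_one \<rho> \<Longrightarrow> \<sigma> \<subseteq> \<rho> \<Longrightarrow> one_one \<sigma>"
  unfolding one_one_def by (meson converse_mono single_valued_subset)

lemma chosen_mono: "F \<subseteq> U \<Longrightarrow> chosen s F \<subseteq> chosen s U"
  unfolding chosen_def by auto

lemma good_mono:
  assumes g: "good \<Phi> A X Y s U" and F: "F \<subseteq> U"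
  shows "good \<Phi> A X Y s F"
proof -
  have "edges (insert (chosen s F) L) ^^ n \<subseteq> edges (insert (chosen s U) L) ^^ n" for L n
    by (intro relpow_mono_reflexive Id_subset_edges)
      (use chosen_mono[OF F, of s] in \<open>auto simp: edges_insert\<close>)
  moreover have "one_one (chosen s F)"
    using one_one_subset[OF _ chosen_mono[OF F]] g unfolding good_def by blast
  moreover have "inj_on s {t \<in> F. is_Evade t}"
    by (rule inj_on_subset[of _ "{t \<in> U. is_Evade t}"]) (use g F in \<open>auto simp: good_def\<close>)
  ultimately show ?thesis
    using g F chosen_mono[OF F, of s] unfolding good_def by blast
qed

lemma good_cong:
  assumes eq: "\<And>t. t \<in> U \<Longrightarrow> s t = s' t" and g: "good \<Phi> A X Y s U"
  shows "good \<Phi> A X Y s' U"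
proof -
  have ch: "chosen s' U = chosen s U" using eq unfolding chosen_def by force
  have inj: "inj_on s' {t \<in> U. is_Evade t} = inj_on s {t \<in> U. is_Evade t}"
    by (rule inj_on_cong) (use eq in auto)
  show ?thesis using g unfolding good_def ch inj using eq by simp
qed

text \<open>Every clause concerns one or two tasks at a time, except that the \<open>Evade\<close>
  clause speaks of all of \<open>chosen s U\<close>; a path violating it would already live on
  finitely many chosen edges.\<close>

lemma good_finite:
  assumes g: "\<And>F. finite F \<Longrightarrow> F \<subseteq> U \<Longrightarrow> good \<Phi> A X Y s F"
  shows "good \<Phi> A X Y s U"
proof -
  have cover: "\<exists>F. finite F \<and> F \<subseteq> U \<and> c \<subseteq> chosen s F" if "finite c" "c \<subseteq> chosen s U" for c
    using finite_subset_image[OF that[unfolded chosen_def]] unfolding chosen_def by blast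
  have pairs: "\<exists>F. finite F \<and> F \<subseteq> U \<and> p \<in> chosen s F \<and> p' \<in> chosen s F"
    if "p \<in> chosen s U" "p' \<in> chosen s U" for p p'
    using cover[of "{p, p'}"] that by auto
  have "one_one (chosen s U)"
    unfolding one_one_def single_valued_def
  proof (intro conjI allI impI)
    fix x y z assume "(x, y) \<in> chosen s U" "(x, z) \<in> chosen s U"
    from pairs[OF this] obtain F where
      F: "finite F" "F \<subseteq> U" "(x, y) \<in> chosen s F" "(x, z) \<in> chosen s F" by blast
    with g[OF F(1,2)] show "y = z" unfolding good_def one_one_def single_valued_def by blast
  next
    fix x y z assume "(x, y) \<in> (chosen s U)\<inverse>" "(x, z) \<in> (chosen s U)\<inverse>"
    then have "(y, x) \<in> chosen s U" "(z, x) \<in> chosen s U" by auto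
    from pairs[OF this] obtain F where
      F: "finite F" "F \<subseteq> U" "(y, x) \<in> chosen s F" "(z, x) \<in> chosen s F" by blast
    with g[OF F(1,2)] show "y = z" unfolding good_def one_one_def single_valued_def by blast
  qed
  moreover have "(x, y) \<in> A \<times> A \<and> (x \<in> X \<longleftrightarrow> y \<in> Y)" if xy: "(x, y) \<in> chosen s U" for x y
  proof -
    from pairs[OF xy xy] obtain F where F: "finite F" "F \<subseteq> U" "(x, y) \<in> chosen s F" by blast
    with g[OF F(1,2)] show ?thesis unfolding good_def by blast
  qed
  moreover have "fst (s (Dom a)) = a" if "Dom a \<in> U" for a
    using g[of "{Dom a}"] that unfolding good_def by auto
  moreover have "snd (s (Ran a)) = a" if "Ran a \<in> U" for a
    using g[of "{Ran a}"] that unfolding good_def by auto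
  moreover have "s t \<in> \<Phi>" if "t \<in> U" "is_Evade t" for t
    using g[of "{t}"] that unfolding good_def by auto
  moreover have "inj_on s {t \<in> U. is_Evade t}"
  proof (rule inj_onI)
    fix t t' assume t: "t \<in> {t \<in> U. is_Evade t}" "t' \<in> {t \<in> U. is_Evade t}" "s t = s t'"
    then have "good \<Phi> A X Y s {t, t'}" by (intro g) auto
    then have "inj_on s {u \<in> {t, t'}. is_Evade u}" unfolding good_def by blast
    then show "t = t'" by (rule inj_onD) (use t in auto)
  qed
  moreover have "s (Evade L n i) \<notin> edges (insert (chosen s U) L) ^^ n" if t: "Evade L n i \<in> U" for L n i
  proof
    assume "s (Evade L n i) \<in> edges (insert (chosen s U) L) ^^ n"
    then obtain q0 where q0: "finite q0" "q0 \<subseteq> chosen s U" "s (Evade L n i) \<in> edges (insert q0 L) ^^ n"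
      using finite_relpow_edges_insert by (metis surj_pair)
    obtain F where F: "finite F" "F \<subseteq> U" "q0 \<subseteq> chosen s F" using cover[OF q0(1,2)] by blast
    let ?F = "insert (Evade L n i) F"
    have "chosen s F \<subseteq> chosen s ?F" by (rule chosen_mono) auto
    then have "edges (insert q0 L) ^^ n \<subseteq> edges (insert (chosen s ?F) L) ^^ n"
      by (intro relpow_mono_reflexive Id_subset_edges) (use F(3) in \<open>auto simp: edges_insert\<close>)
    moreover have "s (Evade L n i) \<notin> edges (insert (chosen s ?F) L) ^^ n"
      using g[of ?F] F t unfolding good_def by blast
    ultimately show False using q0(3) by blast
  qed
  ultimately show ?thesis unfolding good_def by (intro conjI) auto
qed

lemma good_insert_chosen:
  assumes g: "good \<Phi> A X Y s U" and t: "t \<notin> U" "\<not> is_Evade t"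
    and v: "one_one (insert v (chosen s U))" "v \<in> A \<times> A" "fst v \<in> X \<longleftrightarrow> snd v \<in> Y"
    and fr: "\<And>a. t = Dom a \<Longrightarrow> fst v = a" "\<And>a. t = Ran a \<Longrightarrow> snd v = a"
    and ev: "\<And>L n i. Evade L n i \<in> U \<Longrightarrow>
      s (Evade L n i) \<notin> edges (insert (insert v (chosen s U)) L) ^^ n"
  shows "good \<Phi> A X Y (s(t := v)) (insert t U)"
proof -
  have ch: "chosen (s(t := v)) (insert t U) = insert v (chosen s U)"
    using t unfolding chosen_def by auto
  have E: "{t' \<in> insert t U. is_Evade t'} = {t' \<in> U. is_Evade t'}" using t by auto
  have inj: "inj_on (s(t := v)) {t \<in> U. is_Evade t} = inj_on s {t \<in> U. is_Evade t}"
    by (rule inj_on_cong) (use t in auto)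
  show ?thesis unfolding good_def ch E inj
  proof (intro conjI)
    show "\<forall>(x, y)\<in>insert v (chosen s U). (x \<in> X) = (y \<in> Y)"
      using g v(3) unfolding good_def by (cases v) auto
    show "\<forall>L n i. Evade L n i \<in> insert t U \<longrightarrow>
        (s(t := v)) (Evade L n i) \<notin> edges (insert (insert v (chosen s U)) L) ^^ n"
      using ev t by auto
    show "\<forall>t'\<in>insert t U. is_Evade t' \<longrightarrow> (s(t := v)) t' \<in> \<Phi>"
      using g t unfolding good_def by auto
    show "\<forall>a. Dom a \<in> insert t U \<longrightarrow> fst ((s(t := v)) (Dom a)) = a"
      using g t fr(1) unfolding good_def by auto
    show "\<forall>a. Ran a \<in> insert t U \<longrightarrow> snd ((s(t := v)) (Ran a)) = a"
      using g t fr(2) unfolding good_def by auto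
  qed (use g v in \<open>auto simp: good_def\<close>)
qed

lemma good_insert_Evade:
  assumes g: "good \<Phi> A X Y s U" and t: "Evade L n i \<notin> U"
    and v: "v \<in> \<Phi>" "v \<notin> s ` {t \<in> U. is_Evade t}" "v \<notin> edges (insert (chosen s U) L) ^^ n"
  shows "good \<Phi> A X Y (s(Evade L n i := v)) (insert (Evade L n i) U)"
proof -
  let ?t = "Evade L n i" and ?s = "s(Evade L n i := v)"
  have ch: "chosen ?s (insert ?t U) = chosen s U"
    using t unfolding chosen_def by auto
  have E: "{t' \<in> insert ?t U. is_Evade t'} = insert ?t {t' \<in> U. is_Evade t'}" by auto
  have inj: "inj_on ?s (insert ?t {t \<in> U. is_Evade t})"
  proof -
    have "inj_on ?s {t \<in> U. is_Evade t} = inj_on s {t \<in> U. is_Evade t}"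
      by (rule inj_on_cong) (use t in auto)
    moreover have "?s ` {t \<in> U. is_Evade t} = s ` {t \<in> U. is_Evade t}"
      by (rule image_cong) (use t in auto)
    ultimately show ?thesis using g v(2) by (auto simp: good_def)
  qed
  show ?thesis unfolding good_def ch E using g v t inj unfolding good_def by auto
qed

text \<open>There are at most \<kappa> tasks, so each is treated after fewer than \<kappa>
  commitments: \<open>fresh_vertex\<close> supplies partners for \<open>Dom\<close> and
  \<open>Ran\<close>, \<open>fresh_pair\<close> supplies values for \<open>Evade\<close>. The four
  bounds in \<open>big\<close> keep \<kappa> many candidates for every partner.\<close>

lemma generic_permutation:
  fixes \<kappa> :: "'k rel"
  assumes \<kappa>: "Cinfinite \<kappa>" and N: "|N| \<le>o \<kappa>" "\<And>\<rho>. \<rho> \<in> N \<Longrightarrow> one_one \<rho>"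
    and \<Phi>: "one_one \<Phi>" and ev: "evades \<kappa> \<Phi> N"
    and A: "|A| \<le>o \<kappa>" and XY: "X \<subseteq> A" "Y \<subseteq> A"
    and big: "\<kappa> \<le>o |X|" "\<kappa> \<le>o |Y|" "\<kappa> \<le>o |A - X|" "\<kappa> \<le>o |A - Y|"
  shows "\<exists>h. one_one h \<and> Domain h = A \<and> Range h = A \<and> h `` X = Y \<and> evades \<kappa> \<Phi> (insert h N)"
proof -
  define T :: "('a, 'k) task set" where
    "T = Dom ` A \<union> Ran ` A \<union> (\<lambda>(L, n, i). Evade L n i) ` (Fpow N \<times> UNIV \<times> Field \<kappa>)"
  have F\<kappa>: "|Field \<kappa>| \<le>o \<kappa>" using \<kappa> by (simp add: card_of_Field_ordIso ordIso_imp_ordLeq)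
  have "|UNIV :: nat set| \<le>o |Field \<kappa>|"
    using \<kappa> infinite_iff_card_of_nat cinfinite_def by blast
  then have nat: "|UNIV :: nat set| \<le>o \<kappa>" using F\<kappa> ordLeq_transitive by blast
  have T\<kappa>: "|T| \<le>o \<kappa>"
    unfolding T_def
    by (intro Un_ordLeq_Cinfinite[OF \<kappa>] image_ordLeq A Times_ordLeq_Cinfinite[OF \<kappa>] nat F\<kappa>
        Fpow_ordLeq_Cinfinite[OF \<kappa> N(1)])
  have "\<exists>s. good \<Phi> A X Y s T"
  proof (rule transfinite_choice[where T = T and Good = "good \<Phi> A X Y"])
    show "good \<Phi> A X Y s {}" for s :: "('a, 'k) task \<Rightarrow> _"
      by (simp add: good_def chosen_def one_one_def)
  next
    fix s and U :: "('a, 'k) task set" and t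
    assume U: "U \<subseteq> T" "|U| <o |T|" and t: "t \<in> T - U" and g: "good \<Phi> A X Y s U"
    have U\<kappa>: "|U| <o \<kappa>" using U(2) T\<kappa> ordLess_ordLeq_trans by blast
    let ?q = "chosen s U"
    have q\<kappa>: "|?q| <o \<kappa>" unfolding chosen_def
      by (rule image_ordLess, rule subset_ordLess[OF U\<kappa>]) auto
    \<comment> \<open>The promises made so far: pairs of \<Phi> that must stay unjoined, each with
      its letters and length.\<close>
    define Pr where "Pr = {(L, n, a, b). \<exists>i. Evade L n i \<in> U \<and> s (Evade L n i) = (a, b)}"
    have "Pr \<subseteq> (\<lambda>t. case t of Evade L n i \<Rightarrow> (L, n, s t)) ` U"
      unfolding Pr_def by force
    then have Pr\<kappa>: "|Pr| <o \<kappa>" using subset_ordLess[OF image_ordLess[OF U\<kappa>]] by blast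
    have Pr: "finite L \<and> (\<forall>\<rho>\<in>L. one_one \<rho>) \<and> (a, b) \<notin> edges (insert ?q L) ^^ n"
      if "(L, n, a, b) \<in> Pr" for L n a b
    proof -
      from that obtain i where i: "Evade L n i \<in> U" "s (Evade L n i) = (a, b)"
        by (auto simp: Pr_def)
      then have "Evade L n i \<in> T" using U by auto
      then have "L \<in> Fpow N" by (auto simp: T_def)
      then show ?thesis using g i N(2) unfolding good_def Fpow_def by (metis (lifting) mem_Collect_eq subsetD)
    qed
    have qA: "?q \<subseteq> A \<times> A" "one_one ?q" "\<And>x y. (x, y) \<in> ?q \<Longrightarrow> x \<in> X \<longleftrightarrow> y \<in> Y"
      using g unfolding good_def by auto
    show "\<exists>v. good \<Phi> A X Y (s(t := v)) (insert t U)"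
    proof (cases t)
      case (Dom a)
      then have a: "a \<in> A" using t by (auto simp: T_def)
      show ?thesis
      proof (cases "a \<in> Domain ?q")
        case True
        then obtain b where b: "(a, b) \<in> ?q" by auto
        then have ins: "insert (a, b) ?q = ?q" by auto
        have "good \<Phi> A X Y (s(t := (a, b))) (insert t U)"
          by (rule good_insert_chosen[OF g]) (use b ins qA Dom t g in \<open>auto simp: good_def\<close>)
        then show ?thesis ..
      next
        case False
        have V: "\<kappa> \<le>o |if a \<in> X then Y else A - Y|" using big by auto
        obtain b where b: "b \<in> (if a \<in> X then Y else A - Y)" "b \<notin> Field ?q" and
          fresh: "\<forall>(L, n, x, y)\<in>Pr. (x, y) \<notin> edges (insert (insert (a, b) ?q) L) ^^ n"
          using fresh_vertex[OF \<kappa> q\<kappa> Pr\<kappa> V Pr, of a] by blast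
        have fresh': "s (Evade L n i) \<notin> edges (insert (insert (a, b) ?q) L) ^^ n"
          if "Evade L n i \<in> U" for L n i
        proof -
          obtain x y where xy: "s (Evade L n i) = (x, y)" by (cases "s (Evade L n i)")
          then have "(L, n, x, y) \<in> Pr" using that by (auto simp: Pr_def)
          then show ?thesis using fresh xy by auto
        qed
        have "one_one (insert (a, b) ?q)"
          using qA(2) False b(2) unfolding one_one_def single_valued_def Field_def by blast
        moreover have "b \<in> A" "a \<in> X \<longleftrightarrow> b \<in> Y" using b XY by (auto split: if_splits)
        ultimately have "good \<Phi> A X Y (s(t := (a, b))) (insert t U)"
          by (intro good_insert_chosen[OF g])
            (use fresh' a Dom t in auto)
        then show ?thesis ..
      qed
    next
      case (Ran a)
      then have a: "a \<in> A" using t by (auto simp: T_def)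
      show ?thesis
      proof (cases "a \<in> Range ?q")
        case True
        then obtain b where b: "(b, a) \<in> ?q" by auto
        then have ins: "insert (b, a) ?q = ?q" by auto
        have "good \<Phi> A X Y (s(t := (b, a))) (insert t U)"
          by (rule good_insert_chosen[OF g]) (use b ins qA Ran t g in \<open>auto simp: good_def\<close>)
        then show ?thesis ..
      next
        case False
        have V: "\<kappa> \<le>o |if a \<in> Y then X else A - X|" using big by auto
        obtain b where b: "b \<in> (if a \<in> Y then X else A - X)" "b \<notin> Field ?q" and
          fresh: "\<forall>(L, n, x, y)\<in>Pr. (x, y) \<notin> edges (insert (insert (b, a) ?q) L) ^^ n"
          using fresh_vertex[OF \<kappa> q\<kappa> Pr\<kappa> V Pr, of a] by blast
        have fresh': "s (Evade L n i) \<notin> edges (insert (insert (b, a) ?q) L) ^^ n"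
          if "Evade L n i \<in> U" for L n i
        proof -
          obtain x y where xy: "s (Evade L n i) = (x, y)" by (cases "s (Evade L n i)")
          then have "(L, n, x, y) \<in> Pr" using that by (auto simp: Pr_def)
          then show ?thesis using fresh xy by auto
        qed
        have "one_one (insert (b, a) ?q)"
          using qA(2) False b(2) unfolding one_one_def single_valued_def Field_def by blast
        moreover have "b \<in> A" "b \<in> X \<longleftrightarrow> a \<in> Y" using b XY by (auto split: if_splits)
        ultimately have "good \<Phi> A X Y (s(t := (b, a))) (insert t U)"
          by (intro good_insert_chosen[OF g])
            (use fresh' a Ran t in auto)
        then show ?thesis ..
      qed
    next
      case (Evade L n i)
      then have L: "finite L" "L \<subseteq> N" using t by (auto simp: T_def Fpow_def)
      have "|s ` {t \<in> U. is_Evade t}| <o \<kappa>"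
        by (rule image_ordLess, rule subset_ordLess[OF U\<kappa>]) auto
      moreover have "\<kappa> \<le>o |\<Phi> - edges L ^^ n|" using ev L unfolding evades_def by blast
      ultimately obtain v where "v \<in> \<Phi> - s ` {t \<in> U. is_Evade t}" "v \<notin> edges (insert ?q L) ^^ n"
        using fresh_pair[OF \<kappa> q\<kappa> _ \<Phi> L(1)] L(2) N(2) by (metis (no_types, lifting) subsetD)
      then have "good \<Phi> A X Y (s(t := v)) (insert t U)"
        using good_insert_Evade[OF g, of L n i v] t Evade by auto
      then show ?thesis ..
    qed
  next
    show "good \<Phi> A X Y s U" if "\<And>F. finite F \<Longrightarrow> F \<subseteq> U \<Longrightarrow> good \<Phi> A X Y s F"
      for s :: "('a, 'k) task \<Rightarrow> _" and U
      using that by (rule good_finite)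
  qed (fact good_cong, fact good_mono)
  then obtain s where s: "good \<Phi> A X Y s T" ..
  define h where "h = chosen s T"
  have h: "one_one h" "h \<subseteq> A \<times> A" "\<And>x y. (x, y) \<in> h \<Longrightarrow> x \<in> X \<longleftrightarrow> y \<in> Y"
    using s unfolding good_def h_def by auto
  have inh: "s t \<in> h" if "t \<in> T" "\<not> is_Evade t" for t
    using that unfolding h_def chosen_def by auto
  have dom: "a \<in> Domain h" and ran: "a \<in> Range h" if "a \<in> A" for a
  proof -
    have "Dom a \<in> T" "Ran a \<in> T" using that by (auto simp: T_def)
    with s have "fst (s (Dom a)) = a" "snd (s (Ran a)) = a" unfolding good_def by auto
    with inh[OF \<open>Dom a \<in> T\<close>] inh[OF \<open>Ran a \<in> T\<close>] show "a \<in> Domain h" "a \<in> Range h"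
      by (metis Domain_iff Range_iff prod.collapse task.disc)+
  qed
  have "Domain h = A" "Range h = A" using dom ran h(2) by auto
  moreover have "h `` X = Y"
  proof (intro equalityI subsetI)
    fix y assume "y \<in> Y"
    then obtain x where "(x, y) \<in> h" using ran XY by blast
    with h(3) \<open>y \<in> Y\<close> show "y \<in> h `` X" by blast
  qed (use h(3) in auto)
  moreover have "evades \<kappa> \<Phi> (insert h N)" unfolding evades_def
  proof (intro allI impI)
    fix L n assume L: "finite L" "L \<subseteq> insert h N"
    \<comment> \<open>The \<open>Evade\<close> tasks are indexed by finite subsets of
      \<open>N\<close>, so a possible letter \<open>h\<close> is removed here and put back through
      \<open>insert h\<close>.\<close>
    let ?L = "L - {h}"
    have L': "?L \<in> Fpow N" using L by (auto simp: Fpow_def)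
    have sub: "edges L ^^ n \<subseteq> edges (insert h ?L) ^^ n" by (rule edges_relpow_mono) auto
    have "(\<lambda>i. s (Evade ?L n i)) ` Field \<kappa> \<subseteq> \<Phi> - edges L ^^ n"
    proof (rule image_subsetI)
      fix i assume "i \<in> Field \<kappa>"
      then have i: "Evade ?L n i \<in> T" using L' by (auto simp: T_def intro!: image_eqI[of _ _ "(?L, n, i)"])
      then have "s (Evade ?L n i) \<in> \<Phi>" using s unfolding good_def by fastforce
      moreover have "s (Evade ?L n i) \<notin> edges (insert h ?L) ^^ n"
        using s i unfolding good_def h_def by blast
      ultimately show "s (Evade ?L n i) \<in> \<Phi> - edges L ^^ n"
        using sub by blast
    qed
    moreover have "inj_on (\<lambda>i. s (Evade ?L n i)) (Field \<kappa>)"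
    proof (rule inj_onI)
      fix i j assume "i \<in> Field \<kappa>" "j \<in> Field \<kappa>" and eq: "s (Evade ?L n i) = s (Evade ?L n j)"
      then have "Evade ?L n i \<in> T" "Evade ?L n j \<in> T"
        using L' by (auto simp: T_def intro!: image_eqI[of _ _ "(?L, n, _)"])
      moreover have "inj_on s {t \<in> T. is_Evade t}" using s unfolding good_def by auto
      ultimately have "Evade ?L n i = Evade ?L n j" using eq by (intro inj_onD[of s "{t \<in> T. is_Evade t}"]) simp_all
      then show "i = j" by simp
    qed
    ultimately have "|Field \<kappa>| \<le>o |\<Phi> - edges L ^^ n|" using card_of_ordLeq by blast
    then show "\<kappa> \<le>o |\<Phi> - edges L ^^ n|"
      using ordIso_ordLeq_trans[OF ordIso_symmetric[OF card_of_Field_ordIso, of \<kappa>]] \<kappa> by simp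
  qed
  ultimately show ?thesis using h(1) by blast
qed

lemma generic_partial_injection:
  fixes \<kappa> :: "'k rel"
  assumes \<kappa>: "Cinfinite \<kappa>" and N: "|N| \<le>o \<kappa>" "\<And>\<rho>. \<rho> \<in> N \<Longrightarrow> one_one \<rho>" and K: "\<kappa> \<le>o |K|"
  shows "\<exists>\<Phi>. one_one \<Phi> \<and> \<Phi> \<subseteq> K \<times> K \<and> evades \<kappa> \<Phi> N"
proof -
  define T where "T = Fpow N \<times> (UNIV :: nat set) \<times> Field \<kappa>"
  have F\<kappa>: "|Field \<kappa>| \<le>o \<kappa>" using \<kappa> by (simp add: card_of_Field_ordIso ordIso_imp_ordLeq)
  have "|UNIV :: nat set| \<le>o |Field \<kappa>|"
    using \<kappa> infinite_iff_card_of_nat cinfinite_def by blast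
  then have nat: "|UNIV :: nat set| \<le>o \<kappa>" using F\<kappa> ordLeq_transitive by blast
  have T\<kappa>: "|T| \<le>o \<kappa>"
    unfolding T_def
    by (intro Times_ordLeq_Cinfinite[OF \<kappa>] nat F\<kappa> Fpow_ordLeq_Cinfinite[OF \<kappa> N(1)])
  define Good where "Good s U \<longleftrightarrow> (\<forall>t\<in>U. s t \<in> K \<times> K) \<and>
      (\<forall>t\<in>U. \<forall>t'\<in>U. fst (s t) = fst (s t') \<or> snd (s t) = snd (s t') \<longrightarrow> t = t') \<and>
      (\<forall>L n i. (L, n, i) \<in> U \<longrightarrow> s (L, n, i) \<notin> edges L ^^ n)"
    for s and U :: "('a rel set \<times> nat \<times> 'k) set"
  have "\<exists>s. Good s T"
  proof (rule transfinite_choice[where Good = Good])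
    fix s U t
    assume U: "U \<subseteq> T" "|U| <o |T|" and t: "t \<in> T - U" and g: "Good s U"
    obtain L n i where t': "t = (L, n, i)" by (cases t)
    then have L: "finite L" "\<And>\<rho>. \<rho> \<in> L \<Longrightarrow> one_one \<rho>"
      using t N(2) by (auto simp: T_def Fpow_def)
    have U\<kappa>: "|U| <o \<kappa>" using U(2) T\<kappa> ordLess_ordLeq_trans by blast
    have fst\<kappa>: "|(\<lambda>t. fst (s t)) ` U| <o \<kappa>" and snd\<kappa>: "|(\<lambda>t. snd (s t)) ` U| <o \<kappa>"
      using U\<kappa> image_ordLess by blast+
    obtain x where x: "x \<in> K - (\<lambda>t. fst (s t)) ` U" using ordLeq_not_subset_ordLess[OF K fst\<kappa>] by blast
    have "finite ((edges L ^^ n) `` {x})" by (rule finite_edges_relpow_Image[OF L]) auto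
    then have "|(edges L ^^ n) `` {x} \<union> (\<lambda>t. snd (s t)) ` U| <o \<kappa>"
      by (intro Un_ordLess_Cinfinite[OF \<kappa> finite_ordLess_Cinfinite[OF _ \<kappa>] snd\<kappa>])
    from ordLeq_not_subset_ordLess[OF K this] obtain y where
      y: "y \<in> K" "y \<notin> (edges L ^^ n) `` {x}" "y \<notin> (\<lambda>t. snd (s t)) ` U" by blast
    have old: "(s(t := (x, y))) u = s u" if "u \<in> U" for u using that t by auto
    have "Good (s(t := (x, y))) (insert t U)"
      unfolding Good_def
    proof (intro conjI)
      show "\<forall>u\<in>insert t U. (s(t := (x, y))) u \<in> K \<times> K"
        using old g x y(1) unfolding Good_def by auto
      show "\<forall>L n i. (L, n, i) \<in> insert t U \<longrightarrow> (s(t := (x, y))) (L, n, i) \<notin> edges L ^^ n"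
        using old g y(2) t' unfolding Good_def by auto
      have "fst (s u) \<noteq> x" "snd (s u) \<noteq> y" if "u \<in> U" for u using that x y(3) by auto
      then show "\<forall>u\<in>insert t U. \<forall>u'\<in>insert t U.
          fst ((s(t := (x, y))) u) = fst ((s(t := (x, y))) u') \<or>
          snd ((s(t := (x, y))) u) = snd ((s(t := (x, y))) u') \<longrightarrow> u = u'"
        using g old unfolding Good_def by (metis fst_conv fun_upd_same insert_iff snd_conv)
    qed
    then show "\<exists>v. Good (s(t := v)) (insert t U)" ..
  next
    fix s U assume g: "\<And>F. finite F \<Longrightarrow> F \<subseteq> U \<Longrightarrow> Good s F"
    have "Good s {t, t'}" if "t \<in> U" "t' \<in> U" for t t' using g[of "{t, t'}"] that by simp
    then show "Good s U" unfolding Good_def by blast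
  next
    show "Good s' U" if "\<And>t. t \<in> U \<Longrightarrow> s t = s' t" "Good s U" for s s' U
      using that unfolding Good_def by simp
    show "Good s F" if "Good s U" "F \<subseteq> U" for s U F
      using that unfolding Good_def by blast
  qed (simp add: Good_def)
  then obtain s where s: "Good s T" ..
  have eq: "p = p'" if "p \<in> s ` T" "p' \<in> s ` T" "fst p = fst p' \<or> snd p = snd p'" for p p'
    using that s unfolding Good_def by blast
  have "one_one (s ` T)"
    unfolding one_one_def single_valued_def
  proof (intro conjI allI impI)
    show "y = z" if "(x, y) \<in> s ` T" "(x, z) \<in> s ` T" for x y z
      using eq[OF that] by simp
    show "y = z" if "(x, y) \<in> (s ` T)\<inverse>" "(x, z) \<in> (s ` T)\<inverse>" for x y z
      using eq[OF that[unfolded converse_iff]] by simp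
  qed
  moreover have "s ` T \<subseteq> K \<times> K" using s unfolding Good_def by blast
  moreover have "evades \<kappa> (s ` T) N" unfolding evades_def
  proof (intro allI impI)
    fix L n assume L: "finite L" "L \<subseteq> N"
    then have T: "(L, n, i) \<in> T" if "i \<in> Field \<kappa>" for i using that by (auto simp: T_def Fpow_def)
    have "(\<lambda>i. s (L, n, i)) ` Field \<kappa> \<subseteq> s ` T - edges L ^^ n"
      using s T unfolding Good_def by blast
    moreover have "inj_on (\<lambda>i. s (L, n, i)) (Field \<kappa>)"
    proof (rule inj_onI)
      fix i j assume "i \<in> Field \<kappa>" "j \<in> Field \<kappa>" "s (L, n, i) = s (L, n, j)"
      then have "(L, n, i) = (L, n, j)" using s T unfolding Good_def by metis
      then show "i = j" by simp
    qed
    ultimately have "|Field \<kappa>| \<le>o |s ` T - edges L ^^ n|" using card_of_ordLeq by blast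
    then show "\<kappa> \<le>o |s ` T - edges L ^^ n|"
      using ordIso_ordLeq_trans[OF ordIso_symmetric[OF card_of_Field_ordIso, of \<kappa>]] \<kappa> by simp
  qed
  ultimately show ?thesis by blast
qed

section \<open>Isomorphisms between finite intersections\<close>

text \<open>The order clause makes such a map rigid, hence determined by its domain and range. The
  clause on \<open>D\<close> transports members of \<C>, which is what composition needs.\<close>

definition isos :: "'a rel \<Rightarrow> 'a set set \<Rightarrow> 'a rel set" where
  "isos \<mu> \<C> = {\<rho>. one_one \<rho> \<and> Domain \<rho> \<in> \<C> \<and> Range \<rho> \<in> \<C> \<and>
     (\<forall>x y x' y'. (x, y) \<in> \<rho> \<longrightarrow> (x', y') \<in> \<rho> \<longrightarrow> ((x, x') \<in> \<mu> \<longleftrightarrow> (y, y') \<in> \<mu>)) \<and>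
     (\<forall>D\<subseteq>Domain \<rho>. D \<in> \<C> \<longleftrightarrow> \<rho> `` D \<in> \<C>)}"

definition isos_between :: "'a rel \<Rightarrow> 'a set set \<Rightarrow> 'a set \<Rightarrow> 'a set \<Rightarrow> 'a rel set" where
  "isos_between \<mu> \<C> P Q = {\<rho> \<in> isos \<mu> \<C>. Domain \<rho> \<subseteq> P \<and> Range \<rho> \<subseteq> Q}"

section \<open>Converses, compositions and rigidity of the partial isomorphisms\<close>

lemma isosD:
  assumes "\<rho> \<in> isos \<mu> \<C>"
  shows "one_one \<rho>" "Domain \<rho> \<in> \<C>" "Range \<rho> \<in> \<C>"
    "\<And>x y x' y'. (x, y) \<in> \<rho> \<Longrightarrow> (x', y') \<in> \<rho> \<Longrightarrow> (x, x') \<in> \<mu> \<longleftrightarrow> (y, y') \<in> \<mu>"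
    "\<And>D. D \<subseteq> Domain \<rho> \<Longrightarrow> D \<in> \<C> \<longleftrightarrow> \<rho> `` D \<in> \<C>"
  using assms unfolding isos_def by blast+

lemma one_oneD:
  "one_one \<rho> \<Longrightarrow> (x, y) \<in> \<rho> \<Longrightarrow> (x, z) \<in> \<rho> \<Longrightarrow> y = z"
  "one_one \<rho> \<Longrightarrow> (y, x) \<in> \<rho> \<Longrightarrow> (z, x) \<in> \<rho> \<Longrightarrow> y = z"
  unfolding one_one_def by (blast dest: single_valuedD)+

lemma one_one_converse: "one_one \<rho> \<Longrightarrow> one_one (\<rho>\<inverse>)"
  unfolding one_one_def by simp

lemma one_one_relcomp: "one_one \<rho> \<Longrightarrow> one_one \<sigma> \<Longrightarrow> one_one (\<rho> O \<sigma>)"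
  unfolding one_one_def by (simp add: single_valued_relcomp converse_relcomp)

lemma one_one_Image_converse:
  assumes "one_one \<rho>" "E \<subseteq> Range \<rho>" shows "\<rho> `` (\<rho>\<inverse> `` E) = E"
  using one_oneD[OF assms(1)] assms(2) by blast

lemma isos_converse:
  assumes \<rho>: "\<rho> \<in> isos \<mu> \<C>" shows "\<rho>\<inverse> \<in> isos \<mu> \<C>"
proof -
  have "E \<in> \<C> \<longleftrightarrow> \<rho>\<inverse> `` E \<in> \<C>" if "E \<subseteq> Domain (\<rho>\<inverse>)" for E
  proof -
    have "\<rho> `` (\<rho>\<inverse> `` E) = E" by (rule one_one_Image_converse[OF isosD(1)[OF \<rho>]]) (use that in auto)
    moreover have "\<rho>\<inverse> `` E \<subseteq> Domain \<rho>" by auto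
    ultimately show ?thesis using isosD(5)[OF \<rho>, of "\<rho>\<inverse> `` E"] by simp
  qed
  moreover have "(y, y') \<in> \<mu> \<longleftrightarrow> (x, x') \<in> \<mu>" if "(x, y) \<in> \<rho>" "(x', y') \<in> \<rho>" for x y x' y'
    using isosD(4)[OF \<rho> that] by simp
  ultimately show ?thesis
    using isosD(1-3)[OF \<rho>] one_one_converse[of \<rho>] unfolding isos_def by auto
qed

lemma isos_relcomp:
  assumes \<rho>: "\<rho> \<in> isos \<mu> \<C>" and \<sigma>: "\<sigma> \<in> isos \<mu> \<C>"
    and Int: "\<forall>C\<in>\<C>. \<forall>D\<in>\<C>. C \<inter> D \<in> \<C>"
  shows "\<rho> O \<sigma> \<in> isos \<mu> \<C>"
proof -
  \<comment> \<open>The maps meet on \<open>?M\<close>, a member of \<C> by closure under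
    intersection; pulling it back along \<rho> and pushing it forward along \<sigma> gives the
    domain and range of the composition.\<close>
  let ?M = "Range \<rho> \<inter> Domain \<sigma>"
  have M: "?M \<in> \<C>" using isosD[OF \<rho>] isosD[OF \<sigma>] Int by blast
  have "Domain (\<rho> O \<sigma>) = \<rho>\<inverse> `` ?M" by auto
  moreover have "\<rho>\<inverse> `` ?M \<in> \<C>" using isosD(5)[OF isos_converse[OF \<rho>], of ?M] M by auto
  ultimately have dom: "Domain (\<rho> O \<sigma>) \<in> \<C>" by simp
  have "Range (\<rho> O \<sigma>) = \<sigma> `` ?M" by auto
  moreover have "\<sigma> `` ?M \<in> \<C>" using isosD(5)[OF \<sigma>, of ?M] M by auto
  ultimately have ran: "Range (\<rho> O \<sigma>) \<in> \<C>" by simp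
  have im: "D \<in> \<C> \<longleftrightarrow> (\<rho> O \<sigma>) `` D \<in> \<C>" if D: "D \<subseteq> Domain (\<rho> O \<sigma>)" for D
  proof -
    have "D \<subseteq> Domain \<rho>" using D by auto
    moreover have "\<rho> `` D \<subseteq> Domain \<sigma>"
      using D one_oneD(1)[OF isosD(1)[OF \<rho>]] by blast
    ultimately show ?thesis
      using isosD(5)[OF \<rho>, of D] isosD(5)[OF \<sigma>, of "\<rho> `` D"] by (simp add: relcomp_Image)
  qed
  have ord: "(x, x') \<in> \<mu> \<longleftrightarrow> (z, z') \<in> \<mu>" if "(x, z) \<in> \<rho> O \<sigma>" "(x', z') \<in> \<rho> O \<sigma>" for x z x' z'
  proof -
    from that obtain y y' where "(x, y) \<in> \<rho>" "(y, z) \<in> \<sigma>" "(x', y') \<in> \<rho>" "(y', z') \<in> \<sigma>" by blast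
    then show ?thesis using isosD(4)[OF \<rho>, of x y x' y'] isosD(4)[OF \<sigma>, of y z y' z'] by simp
  qed
  show ?thesis
    unfolding isos_def mem_Collect_eq
    by (intro conjI one_one_relcomp isosD(1)[OF \<rho>] isosD(1)[OF \<sigma>] dom ran)
      (use im ord in blast)+
qed

lemma Id_on_isos:
  assumes "C \<in> \<C>" shows "Id_on C \<in> isos \<mu> \<C>"
proof -
  have "Id_on C `` D = D" if "D \<subseteq> C" for D using that by auto
  then show ?thesis
    using assms unfolding isos_def one_one_def by (simp add: single_valued_Id_on) auto
qed

text \<open>Rigidity of well-orders. At a least disagreement, the smaller of the two values is taken
  by the other map at an earlier argument, where the maps agree; this contradicts injectivity. The
  converse inclusion follows by symmetry.\<close>

lemma isos_subset:
  assumes wo: "Well_order \<mu>" and \<rho>: "\<rho> \<in> isos \<mu> \<C>" and \<sigma>: "\<sigma> \<in> isos \<mu> \<C>"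
    and eq: "Domain \<rho> = Domain \<sigma>" "Range \<rho> = Range \<sigma>" and fld: "Range \<rho> \<subseteq> Field \<mu>"
  shows "\<rho> \<subseteq> \<sigma>"
proof -
  have W: "wo_rel \<mu>" by (rule wo_rel.intro[OF wo])
  note inj = one_oneD[OF isosD(1)[OF \<rho>]] one_oneD[OF isosD(1)[OF \<sigma>]]
  have "\<forall>y. (x, y) \<in> \<rho> \<longrightarrow> (x, y) \<in> \<sigma>" for x
  proof (induction x rule: wf_induct_rule[OF wo_rel.WF[OF W]])
    case (1 x)
    show ?case
    proof (intro allI impI)
      fix y assume xy: "(x, y) \<in> \<rho>"
      then obtain z where xz: "(x, z) \<in> \<sigma>" using eq by blast
      show "(x, y) \<in> \<sigma>"
      proof (cases "y = z")
        case False
        have "y \<in> Field \<mu>" "z \<in> Field \<mu>" using xy xz eq fld by blast+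
        then consider "(y, z) \<in> \<mu>" | "(z, y) \<in> \<mu>" using wo_rel.TOTALS[OF W] by blast
        then show ?thesis
        proof cases
          case 1
          obtain w where w: "(w, y) \<in> \<sigma>" using xy eq by blast
          have "(w, x) \<in> \<mu>" using isosD(4)[OF \<sigma> w xz] 1 by simp
          moreover have "w \<noteq> x" using w xz False inj by blast
          moreover obtain u where u: "(w, u) \<in> \<rho>" using w eq by blast
          ultimately have "(w, u) \<in> \<sigma>" using "1.IH"[of w] by blast
          then have "u = y" using w inj by blast
          then show ?thesis using u xy inj \<open>w \<noteq> x\<close> by blast
        next
          case 2
          obtain w where w: "(w, z) \<in> \<rho>" using xz eq by blast
          have "(w, x) \<in> \<mu>" using isosD(4)[OF \<rho> w xy] 2 by simp
          moreover have "w \<noteq> x" using w xy False inj by blast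
          ultimately have "(w, z) \<in> \<sigma>" using "1.IH"[of w] w by blast
          then show ?thesis using xz inj \<open>w \<noteq> x\<close> by blast
        qed
      qed (use xz in simp)
    qed
  qed
  then show ?thesis by auto
qed

text \<open>By rigidity a map is encoded by its domain and range, and there are at most \<kappa>
  candidates for each.\<close>

lemma card_isos_between:
  assumes \<kappa>: "Cinfinite \<kappa>" and wo: "Well_order \<mu>" and fld: "\<And>C. C \<in> \<C> \<Longrightarrow> C \<subseteq> Field \<mu>"
    and small: "|{D \<in> \<C>. D \<subseteq> P}| \<le>o \<kappa>" "|{D \<in> \<C>. D \<subseteq> Q}| \<le>o \<kappa>"
  shows "|isos_between \<mu> \<C> P Q| \<le>o \<kappa>"
proof -
  let ?f = "\<lambda>\<rho>. (Domain \<rho>, Range \<rho>)"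
  have "inj_on ?f (isos_between \<mu> \<C> P Q)"
  proof (rule inj_onI)
    fix \<rho> \<sigma> assume "\<rho> \<in> isos_between \<mu> \<C> P Q" "\<sigma> \<in> isos_between \<mu> \<C> P Q" "?f \<rho> = ?f \<sigma>"
    then have "\<rho> \<in> isos \<mu> \<C>" "\<sigma> \<in> isos \<mu> \<C>" "Domain \<rho> = Domain \<sigma>" "Range \<rho> = Range \<sigma>"
      unfolding isos_between_def by auto
    then show "\<rho> = \<sigma>"
      using isos_subset[OF wo, of \<rho> \<C> \<sigma>] isos_subset[OF wo, of \<sigma> \<C> \<rho>] fld isosD(3) by (metis subset_antisym)
  qed
  moreover have "?f ` isos_between \<mu> \<C> P Q \<subseteq> {D \<in> \<C>. D \<subseteq> P} \<times> {D \<in> \<C>. D \<subseteq> Q}"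
    unfolding isos_between_def using isosD(2,3) by auto
  ultimately have "|isos_between \<mu> \<C> P Q| \<le>o |{D \<in> \<C>. D \<subseteq> P} \<times> {D \<in> \<C>. D \<subseteq> Q}|"
    using card_of_ordLeq by blast
  then show ?thesis using Times_ordLeq_Cinfinite[OF \<kappa> small] by (rule ordLeq_transitive)
qed

text \<open>Paths of length \<open>n\<close> over finitely many letters spell finitely many
  compositions, and these are again isomorphisms. Starting in \<open>P\<close> lets
  \<open>Id_on P\<close> stand for the empty path, since \<open>Id\<close> itself need not be in
  \<open>isos \<mu> \<C>\<close>.\<close>

lemma isos_paths_from:
  assumes Int: "\<forall>C\<in>\<C>. \<forall>D\<in>\<C>. C \<inter> D \<in> \<C>"
    and L: "finite L" "L \<subseteq> isos \<mu> \<C>" and P: "P \<in> \<C>"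
  shows "\<exists>F. finite F \<and> F \<subseteq> isos \<mu> \<C> \<and> edges L ^^ n \<inter> P \<times> UNIV \<subseteq> \<Union>F"
proof (induction n)
  case 0
  show ?case by (rule exI[of _ "{Id_on P}"]) (use P Id_on_isos in auto)
next
  case (Suc n)
  then obtain F where F: "finite F" "F \<subseteq> isos \<mu> \<C>" "edges L ^^ n \<inter> P \<times> UNIV \<subseteq> \<Union>F" by blast
  let ?F = "F \<union> (\<lambda>(\<rho>, \<sigma>). \<rho> O \<sigma>) ` (F \<times> (L \<union> converse ` L))"
  have "finite ?F" using F(1) L(1) by simp
  moreover have "\<sigma> \<in> isos \<mu> \<C>" if "\<sigma> \<in> L \<union> converse ` L" for \<sigma>
    using that L(2) isos_converse by blast
  then have "?F \<subseteq> isos \<mu> \<C>"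
    using F(2) isos_relcomp[OF _ _ Int] by auto
  moreover have "edges L ^^ Suc n \<inter> P \<times> UNIV \<subseteq> \<Union>?F"
  proof (rule subrelI)
    fix x z assume "(x, z) \<in> edges L ^^ Suc n \<inter> P \<times> UNIV"
    then obtain y where y: "x \<in> P" "(x, y) \<in> edges L ^^ n" "(y, z) \<in> edges L" by auto
    then obtain \<rho> where \<rho>: "\<rho> \<in> F" "(x, y) \<in> \<rho>" using F(3) by blast
    consider "y = z" | \<sigma> where "\<sigma> \<in> L \<union> converse ` L" "(y, z) \<in> \<sigma>"
      using y(3) unfolding edges_def by blast
    then show "(x, z) \<in> \<Union>?F"
    proof cases
      case 1
      then show ?thesis using \<rho> by (intro UnionI[of \<rho>]) simp_all
    next
      case 2
      then have "\<rho> O \<sigma> \<in> ?F" "(x, z) \<in> \<rho> O \<sigma>" using \<rho> by blast+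
      then show ?thesis by (rule UnionI)
    qed
  qed
  ultimately show ?case by blast
qed

lemma isos_paths_between:
  assumes Int: "\<forall>C\<in>\<C>. \<forall>D\<in>\<C>. C \<inter> D \<in> \<C>"
    and L: "finite L" "L \<subseteq> isos \<mu> \<C>" and P: "P \<in> \<C>" and Q: "Q \<in> \<C>"
  shows "\<exists>F. finite F \<and> F \<subseteq> isos_between \<mu> \<C> P Q \<and> edges L ^^ n \<inter> P \<times> Q \<subseteq> \<Union>F"
proof -
  obtain F where F: "finite F" "F \<subseteq> isos \<mu> \<C>" "edges L ^^ n \<inter> P \<times> UNIV \<subseteq> \<Union>F"
    using isos_paths_from[OF Int L P, of n] by (elim exE conjE)
  \<comment> \<open>Composing with identities on members of \<C> restricts a map to \<open>P\<close>
    and \<open>Q\<close> without leaving \<open>isos \<mu> \<C>\<close>.\<close>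
  let ?r = "\<lambda>\<rho>. Id_on P O \<rho> O Id_on Q"
  have "?r \<rho> \<in> isos \<mu> \<C>" if "\<rho> \<in> F" for \<rho>
    using that F(2) by (intro isos_relcomp Id_on_isos P Q Int) auto
  then have "?r ` F \<subseteq> isos_between \<mu> \<C> P Q" unfolding isos_between_def by auto
  moreover have "edges L ^^ n \<inter> P \<times> Q \<subseteq> \<Union>(?r ` F)" using F(3) by fastforce
  ultimately show ?thesis using F(1) by blast
qed

text \<open>Along a path, the isomorphisms traversed between two steps of \<open>H\<close> compose to a single
  isomorphism between members of \<open>\<D>\<close>; so the letters from \<open>isos_between\<close> suffice.\<close>
lemma evades_isos:
  assumes Int: "\<forall>C\<in>\<C>. \<forall>D\<in>\<C>. C \<inter> D \<in> \<C>"
    and \<Phi>: "\<Phi> \<subseteq> K \<times> K" and \<D>: "\<D> \<subseteq> \<C>" "K \<in> \<D>" and H: "\<And>h. h \<in> H \<Longrightarrow> \<exists>P\<in>\<D>. h \<subseteq> P \<times> P"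
    and ev: "evades \<kappa> \<Phi> ((\<Union>P\<in>\<D>. \<Union>Q\<in>\<D>. isos_between \<mu> \<C> P Q) \<union> H)"
  shows "evades \<kappa> \<Phi> (isos \<mu> \<C> \<union> H)"
  unfolding evades_def
proof (intro allI impI)
  fix L n assume L: "finite L" "L \<subseteq> isos \<mu> \<C> \<union> H"
  define L1 L2 where "L1 = L \<inter> isos \<mu> \<C>" and "L2 = L - isos \<mu> \<C>"
  have L12: "finite L1" "L1 \<subseteq> isos \<mu> \<C>" "finite L2" "L2 \<subseteq> H" "L = L1 \<union> L2"
    using L by (auto simp: L1_def L2_def)
  obtain p where p: "\<And>h. h \<in> L2 \<Longrightarrow> p h \<in> \<D> \<and> h \<subseteq> p h \<times> p h"
    using H L12(4) by (metis subsetD)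
  \<comment> \<open>The finitely many checkpoints: the set \<open>K\<close> carrying \<Phi>, and a
    support for each letter that is not an isomorphism.\<close>
  define D where "D = insert K (p ` L2)"
  have D: "finite D" "D \<subseteq> \<D>" "K \<in> D" using L12(3) p \<D>(2) by (auto simp: D_def)
  have "\<forall>PQ\<in>D \<times> D. \<exists>F. finite F \<and> F \<subseteq> isos_between \<mu> \<C> (fst PQ) (snd PQ) \<and>
      edges L1 ^^ n \<inter> fst PQ \<times> snd PQ \<subseteq> \<Union>F"
  proof
    fix PQ assume "PQ \<in> D \<times> D"
    then have "fst PQ \<in> \<C>" "snd PQ \<in> \<C>" using D(2) \<D>(1) by auto
    then show "\<exists>F. finite F \<and> F \<subseteq> isos_between \<mu> \<C> (fst PQ) (snd PQ) \<and>
        edges L1 ^^ n \<inter> fst PQ \<times> snd PQ \<subseteq> \<Union>F"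
      by (rule isos_paths_between[OF Int L12(1,2)])
  qed
  from bchoice[OF this] obtain F where F': "\<forall>PQ\<in>D \<times> D. finite (F PQ) \<and>
      F PQ \<subseteq> isos_between \<mu> \<C> (fst PQ) (snd PQ) \<and> edges L1 ^^ n \<inter> fst PQ \<times> snd PQ \<subseteq> \<Union>(F PQ)"
    by (elim exE)
  have F: "finite (F (P, Q)) \<and> F (P, Q) \<subseteq> isos_between \<mu> \<C> P Q \<and>
      edges L1 ^^ n \<inter> P \<times> Q \<subseteq> \<Union>(F (P, Q))" if "P \<in> D" "Q \<in> D" for P Q
    using bspec[OF F', of "(P, Q)"] that by simp
  define M where "M = (\<Union>PQ\<in>D \<times> D. F PQ) \<union> L2"
  have finM: "finite M" using F D(1) L12(3) unfolding M_def by auto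
  have MN: "M \<subseteq> (\<Union>P\<in>\<D>. \<Union>Q\<in>\<D>. isos_between \<mu> \<C> P Q) \<union> H"
  proof
    fix \<rho> assume "\<rho> \<in> M"
    then consider P Q where "P \<in> D" "Q \<in> D" "\<rho> \<in> F (P, Q)" | "\<rho> \<in> L2" by (auto simp: M_def)
    then show "\<rho> \<in> (\<Union>P\<in>\<D>. \<Union>Q\<in>\<D>. isos_between \<mu> \<C> P Q) \<union> H"
    proof cases
      case 1
      then have "\<rho> \<in> isos_between \<mu> \<C> P Q" "P \<in> \<D>" "Q \<in> \<D>" using F[of P Q] D(2) by auto
      then show ?thesis by blast
    qed (use L12(4) in blast)
  qed
  \<comment> \<open>A stretch of at most \<open>n\<close> isomorphism steps between two checkpoints
    collapses to one step of \<open>M\<close>.\<close>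
  have jump: "(z, y) \<in> edges M" if "(z, y) \<in> edges L1 ^^ k" "k \<le> n" "z \<in> P" "P \<in> D" "y \<in> Q" "Q \<in> D" for z y P Q k
  proof -
    have "(z, y) \<in> edges L1 ^^ n \<inter> P \<times> Q"
      using that edges_relpow_mono[of L1 L1 k n] by auto
    then have "(z, y) \<in> \<Union>(F (P, Q))" using F[of P Q] that(4,6) by auto
    moreover have "F (P, Q) \<subseteq> M" using that(4,6) unfolding M_def by auto
    ultimately show ?thesis unfolding edges_def by auto
  qed
  \<comment> \<open>Here \<open>z\<close> is a checkpoint visit after which only isomorphism steps
    have occurred, still pending. A step of \<open>H\<close> costs at most two steps of
    \<open>M\<close>, the pending jump and the step itself, hence \<open>2 * k\<close>.\<close>
  have path: "\<exists>z P. P \<in> D \<and> z \<in> P \<and> (x, z) \<in> edges M ^^ (2 * k) \<and> (z, y) \<in> edges L1 ^^ k"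
    if "x \<in> K" "k \<le> n" "(x, y) \<in> edges L ^^ k" for x y k
    using that
  proof (induction k arbitrary: y)
    case 0
    then show ?case using D(3) by auto
  next
    case (Suc k)
    then obtain w where w: "(x, w) \<in> edges L ^^ k" "(w, y) \<in> edges L" by auto
    with Suc obtain z P where z: "P \<in> D" "z \<in> P" "(x, z) \<in> edges M ^^ (2 * k)" "(z, w) \<in> edges L1 ^^ k"
      by (metis Suc_leD)
    consider "(w, y) \<in> edges L1" | h where "h \<in> L2" "(w, y) \<in> h \<union> h\<inverse>"
      using w(2) unfolding L12(5) edges_def by blast
    then show ?case
    proof cases
      case 1
      have "(x, z) \<in> edges M ^^ (2 * Suc k)"
        using z(3) edges_relpow_mono[of M M "2 * k" "2 * Suc k"] by auto
      moreover have "(z, y) \<in> edges L1 ^^ Suc k" using z(4) 1 by auto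
      ultimately show ?thesis using z(1,2) by blast
    next
      case 2
      have "w \<in> p h" "y \<in> p h" using p[OF 2(1)] 2(2) by blast+
      moreover have pD: "p h \<in> D" using 2(1) by (simp add: D_def)
      ultimately have "(z, w) \<in> edges M" using jump[OF z(4) _ z(2,1)] Suc.prems(2) by auto
      moreover have "(w, y) \<in> edges M" using 2 unfolding edges_def M_def by blast
      ultimately have "(x, y) \<in> edges M ^^ (2 * Suc k)" using z(3) by auto
      moreover have "(y, y) \<in> edges L1 ^^ Suc k"
        using edges_relpow_mono[of L1 L1 0 "Suc k"] by auto
      ultimately show ?thesis using pD \<open>y \<in> p h\<close> by blast
    qed
  qed
  \<comment> \<open>The extra step is the last jump, which lands in the checkpoint
    \<open>K\<close>.\<close>
  have "edges L ^^ n \<inter> K \<times> K \<subseteq> edges M ^^ Suc (2 * n)"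
  proof (rule subrelI)
    fix x y assume xy: "(x, y) \<in> edges L ^^ n \<inter> K \<times> K"
    then obtain z P where z: "P \<in> D" "z \<in> P" "(x, z) \<in> edges M ^^ (2 * n)" "(z, y) \<in> edges L1 ^^ n"
      using path[of x n y] by blast
    then have "(z, y) \<in> edges M" using jump[OF z(4) order.refl z(2,1)] xy D(3) by blast
    then show "(x, y) \<in> edges M ^^ Suc (2 * n)" using z(3) by auto
  qed
  then have "\<Phi> - edges M ^^ Suc (2 * n) \<subseteq> \<Phi> - edges L ^^ n" using \<Phi> by blast
  moreover have "\<kappa> \<le>o |\<Phi> - edges M ^^ Suc (2 * n)|" using ev finM MN unfolding evades_def by blast
  ultimately show "\<kappa> \<le>o |\<Phi> - edges L ^^ n|" using ordLeq_transitive[OF _ card_of_mono1] by simp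
qed

section \<open>Isomorphism types\<close>

definition realizes :: "'a rel \<Rightarrow> 'a set \<times> 'a set \<times> 'a set \<Rightarrow> bool" where
  "realizes h t \<longleftrightarrow> (case t of (A, X, Y) \<Rightarrow>
     one_one h \<and> Domain h = A \<and> Range h = A \<and> h `` X = Y)"

lemma evades_mono: "evades \<kappa> \<Phi> N \<Longrightarrow> M \<subseteq> N \<Longrightarrow> evades \<kappa> \<Phi> M"
  unfolding evades_def by blast

text \<open>The recursion may have length \<open>cardSuc \<kappa>\<close>, but each stage has at
  most \<kappa> predecessors. There may be more than \<kappa> isomorphisms in all;
  \<open>evades_isos\<close> reduces to those between the at most \<kappa> supports seen so far, so
  that \<open>generic_permutation\<close> applies.\<close>

lemma generic_permutations:
  fixes \<kappa> :: "'k rel" and \<mu> :: "'a rel"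
  assumes \<kappa>: "Cinfinite \<kappa>" and wo: "Well_order \<mu>"
    and Int: "\<forall>C\<in>\<C>. \<forall>D\<in>\<C>. C \<inter> D \<in> \<C>" and fld: "\<And>C. C \<in> \<C> \<Longrightarrow> C \<subseteq> Field \<mu>"
    and small: "\<And>C. C \<in> \<C> \<Longrightarrow> |{D \<in> \<C>. D \<subseteq> C}| \<le>o \<kappa>"
    and K: "K \<in> \<C>" "\<kappa> \<le>o |K|" and R: "|R| \<le>o cardSuc \<kappa>"
    and tasks: "\<And>A X Y. (A, X, Y) \<in> R \<Longrightarrow> A \<in> \<C> \<and> |A| \<le>o \<kappa> \<and> X \<subseteq> A \<and> Y \<subseteq> A \<and>
      \<kappa> \<le>o |X| \<and> \<kappa> \<le>o |Y| \<and> \<kappa> \<le>o |A - X| \<and> \<kappa> \<le>o |A - Y|"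
  shows "\<exists>\<Phi> h. one_one \<Phi> \<and> \<Phi> \<subseteq> K \<times> K \<and> (\<forall>t\<in>R. realizes (h t) t) \<and>
    evades \<kappa> \<Phi> (isos \<mu> \<C> \<union> h ` R)"
proof -
  have between: "|isos_between \<mu> \<C> P Q| \<le>o \<kappa>" if "P \<in> \<C>" "Q \<in> \<C>" for P Q
    by (rule card_isos_between[OF \<kappa> wo fld small[OF that(1)] small[OF that(2)]])
  have oo: "one_one \<rho>" if "\<rho> \<in> isos_between \<mu> \<C> P Q" for \<rho> P Q
    using that isosD(1) unfolding isos_between_def by blast
  obtain \<Phi> where \<Phi>: "one_one \<Phi>" "\<Phi> \<subseteq> K \<times> K" "evades \<kappa> \<Phi> (isos_between \<mu> \<C> K K)"
    using generic_partial_injection[OF \<kappa> between[OF K(1) K(1)] oo[of _ K K] K(2)] by blast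
  define Good where "Good h U \<longleftrightarrow> evades \<kappa> \<Phi> (isos \<mu> \<C> \<union> h ` U) \<and> (\<forall>t\<in>U. realizes (h t) t)"
    for h and U :: "('a set \<times> 'a set \<times> 'a set) set"
  \<comment> \<open>With no permutations yet, \<open>K\<close> is the only checkpoint, so evading
    the isomorphisms inside \<open>K\<close> suffices.\<close>
  have base: "evades \<kappa> \<Phi> (isos \<mu> \<C> \<union> {})"
    by (rule evades_isos[OF Int \<Phi>(2), of "{K}"]) (use K(1) \<Phi>(3) in auto)
  have "\<exists>h. Good h R"
  proof (rule transfinite_choice[where Good = Good])
    show "Good h {}" for h using base by (simp add: Good_def)
    show "Good h' U" if "\<And>t. t \<in> U \<Longrightarrow> h t = h' t" "Good h U" for h h' U
    proof -
      have "h ` U = h' ` U" using that(1) by (rule image_cong[OF refl])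
      then show ?thesis using that unfolding Good_def by simp
    qed
    show "Good h F" if "Good h U" "F \<subseteq> U" for h U F
    proof -
      have "isos \<mu> \<C> \<union> h ` F \<subseteq> isos \<mu> \<C> \<union> h ` U" using that(2) by blast
      then have "evades \<kappa> \<Phi> (isos \<mu> \<C> \<union> h ` F)"
        by (rule evades_mono[rotated]) (use that(1) in \<open>simp add: Good_def\<close>)
      then show ?thesis using that unfolding Good_def by blast
    qed
  next
    fix h U assume "\<And>F. finite F \<Longrightarrow> F \<subseteq> U \<Longrightarrow> Good h F"
    then have fin: "Good h F" if "finite F" "F \<subseteq> U" for F using that by simp
    have "evades \<kappa> \<Phi> (isos \<mu> \<C> \<union> h ` U)" unfolding evades_def
    proof (intro allI impI)
      fix L n assume L: "finite L" "L \<subseteq> isos \<mu> \<C> \<union> h ` U"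
      \<comment> \<open>Only finitely many of the chosen permutations occur in \<open>L\<close>, so
        a finite set of indices accounts for them.\<close>
      then have "finite (L - isos \<mu> \<C>)" "L - isos \<mu> \<C> \<subseteq> h ` U" by auto
      from finite_subset_image[OF this] obtain F where
        F: "F \<subseteq> U" "finite F" "L - isos \<mu> \<C> = h ` F" by (elim exE conjE)
      then have "L \<subseteq> isos \<mu> \<C> \<union> h ` F" by blast
      moreover have "evades \<kappa> \<Phi> (isos \<mu> \<C> \<union> h ` F)" using fin[OF F(2,1)] by (simp add: Good_def)
      ultimately show "\<kappa> \<le>o |\<Phi> - edges L ^^ n|" using L(1) unfolding evades_def by simp
    qed
    moreover have "realizes (h t) t" if "t \<in> U" for t
      using fin[of "{t}"] that by (simp add: Good_def)
    ultimately show "Good h U" by (simp add: Good_def)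
  next
    fix h U t assume U: "U \<subseteq> R" "|U| <o |R|" and t: "t \<in> R - U" and g: "Good h U"
    obtain A X Y where AXY: "t = (A, X, Y)" by (cases t)
    with t have "(A, X, Y) \<in> R" by simp
    note task = tasks[OF this]
    have "|U| <o cardSuc \<kappa>" using U(2) R ordLess_ordLeq_trans by blast
    then have U\<kappa>: "|U| \<le>o \<kappa>"
      using cardSuc_ordLeq_ordLess[of \<kappa> "|U|"] \<kappa> card_of_Card_order by blast
    define \<D> where "\<D> = insert K (insert A (fst ` U))"
    have "fst u \<in> \<C>" if "u \<in> U" for u
      using that U(1) tasks by (cases u) auto
    then have \<D>: "\<D> \<subseteq> \<C>" "K \<in> \<D>" "A \<in> \<D>" using K(1) task unfolding \<D>_def by auto
    have "\<D> = {K, A} \<union> fst ` U" by (auto simp: \<D>_def)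
    then have \<D>\<kappa>: "|\<D>| \<le>o \<kappa>"
      using Un_ordLeq_Cinfinite[OF \<kappa> ordLess_imp_ordLeq[OF finite_ordLess_Cinfinite[OF _ \<kappa>, of "{K, A}"]]
          image_ordLeq[OF U\<kappa>, of fst]] by simp
    let ?I = "\<Union>P\<in>\<D>. \<Union>Q\<in>\<D>. isos_between \<mu> \<C> P Q"
    have "|?I| \<le>o \<kappa>"
      by (intro UN_ordLeq_Cinfinite[OF \<kappa> \<D>\<kappa>] between) (use \<D>(1) in auto)
    then have N\<kappa>: "|?I \<union> h ` U| \<le>o \<kappa>" by (rule Un_ordLeq_Cinfinite[OF \<kappa> _ image_ordLeq[OF U\<kappa>]])
    have N1: "one_one \<rho>" if \<rho>: "\<rho> \<in> ?I \<union> h ` U" for \<rho>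
    proof (cases "\<rho> \<in> ?I")
      case False
      then obtain u where "u \<in> U" "\<rho> = h u" using \<rho> by auto
      then show ?thesis using g unfolding Good_def realizes_def by (auto split: prod.splits)
    qed (use oo in blast)
    have ev: "evades \<kappa> \<Phi> (?I \<union> h ` U)"
      by (rule evades_mono[of _ _ "isos \<mu> \<C> \<union> h ` U"])
        (use g in \<open>auto simp: Good_def isos_between_def\<close>)
    obtain k where k: "one_one k" "Domain k = A" "Range k = A" "k `` X = Y"
      "evades \<kappa> \<Phi> (insert k (?I \<union> h ` U))"
      using generic_permutation[OF \<kappa> N\<kappa> N1 \<Phi>(1) ev, of A X Y] task by blast
    have H: "\<exists>P\<in>\<D>. \<rho> \<subseteq> P \<times> P" if "\<rho> \<in> insert k (h ` U)" for \<rho>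
      using that
    proof (rule insertE)
      assume "\<rho> = k"
      moreover have "k \<subseteq> A \<times> A" using k(2,3) by auto
      ultimately show ?thesis using \<D>(3) by blast
    next
      assume "\<rho> \<in> h ` U"
      then obtain u where u: "u \<in> U" "\<rho> = h u" by auto
      then have "realizes \<rho> u" using g by (simp add: Good_def)
      then have "\<rho> \<subseteq> fst u \<times> fst u" unfolding realizes_def by (auto split: prod.splits)
      then show ?thesis using u(1) unfolding \<D>_def by blast
    qed
    \<comment> \<open>The new permutation lives on \<open>A\<close>, itself a member of \<D>; so
      evasion extends from the small family back to all isomorphisms.\<close>
    have "evades \<kappa> \<Phi> (isos \<mu> \<C> \<union> insert k (h ` U))"
      by (rule evades_isos[OF Int \<Phi>(2) \<D>(1,2) H]) (use k(5) in simp_all)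
    moreover have im: "(h(t := k)) ` insert t U = insert k (h ` U)" using t by auto
    moreover have "realizes ((h(t := k)) u) u" if "u \<in> insert t U" for u
    proof (cases "u = t")
      case True
      then show ?thesis using k(1-4) AXY by (simp add: realizes_def)
    next
      case False
      then show ?thesis using that g by (simp add: Good_def)
    qed
    ultimately have "Good (h(t := k)) (insert t U)" unfolding Good_def im by simp
    then show "\<exists>k. Good (h(t := k)) (insert t U)" ..
  qed
  then obtain h where "Good h R" ..
  then show ?thesis using \<Phi>(1,2) unfolding Good_def by blast
qed

text \<open>A copy inside \<open>S\<close> of \<open>(A, X, Y)\<close>, of its order and of its traces, where \<open>d\<close> enumerates the
  traces and \<open>e\<close> injects \<open>A\<close> into \<open>S\<close>.\<close>
definition code :: "'a rel \<Rightarrow> 'k set \<Rightarrow> ('a \<Rightarrow> 'k) \<Rightarrow> ('k \<Rightarrow> 'a set) \<Rightarrow> 'a set \<times> 'a set \<times> 'a set \<Rightarrow>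
    'k rel \<times> 'k set \<times> 'k set \<times> 'k set \<times> 'k rel" where
  "code \<mu> S e d t = (case t of (A, X, Y) \<Rightarrow>
     (map_prod e e ` (\<mu> \<inter> A \<times> A), e ` A, e ` X, e ` Y, SIGMA i:S. e ` d i))"

text \<open>Equal codes mean that both structures have the same copy in \<open>S\<close>; following
  \<open>e\<close> forwards and \<open>e'\<close> backwards is then an isomorphism.\<close>

lemma iso_of_code_eq:
  assumes e: "inj_on e A" "inj_on e' A'"
    and d: "d ` S = {D \<in> \<C>. D \<subseteq> A}" "d' ` S = {D \<in> \<C>. D \<subseteq> A'}"
    and sub: "A \<in> \<C>" "X \<subseteq> A" "Y \<subseteq> A" "A' \<in> \<C>" "X' \<subseteq> A'" "Y' \<subseteq> A'"
    and eq: "code \<mu> S e d (A, X, Y) = code \<mu> S e' d' (A', X', Y')"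
  shows "\<exists>\<rho>\<in>isos \<mu> \<C>. Domain \<rho> = A \<and> Range \<rho> = A' \<and> \<rho> `` X = X' \<and> \<rho> `` Y = Y'"
proof -
  have ord: "map_prod e e ` (\<mu> \<inter> A \<times> A) = map_prod e' e' ` (\<mu> \<inter> A' \<times> A')"
    and im: "e ` A = e' ` A'" "e ` X = e' ` X'" "e ` Y = e' ` Y'"
    and sig: "(SIGMA i:S. e ` d i) = (SIGMA i:S. e' ` d' i)"
    using eq unfolding code_def by auto
  have dd: "e ` d i = e' ` d' i" if "i \<in> S" for i
    using arg_cong[OF sig, of "\<lambda>Z. Z `` {i}"] that by auto
  define \<rho> where "\<rho> = {(a, b). a \<in> A \<and> b \<in> A' \<and> e a = e' b}"
  have img: "e' ` (\<rho> `` D) = e ` D" if D: "D \<subseteq> A" for D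
  proof (intro equalityI subsetI)
    fix z assume "z \<in> e ` D"
    then obtain a where a: "a \<in> D" "z = e a" by auto
    then have "e a \<in> e' ` A'" using D im(1) by blast
    then obtain b where "b \<in> A'" "e a = e' b" by auto
    then show "z \<in> e' ` (\<rho> `` D)" using a D unfolding \<rho>_def by auto
  next
    fix z assume "z \<in> e' ` (\<rho> `` D)"
    then obtain a b where "a \<in> D" "z = e' b" "e a = e' b" unfolding \<rho>_def by blast
    then show "z \<in> e ` D" by (metis imageI)
  qed
  have target: "\<rho> `` D = E" if "D \<subseteq> A" "E \<subseteq> A'" "e ` D = e' ` E" for D E
  proof -
    have "\<rho> `` D \<subseteq> A'" by (auto simp: \<rho>_def)
    then show ?thesis using inj_on_image_eq_iff[OF e(2), of "\<rho> `` D" E] that img by simp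
  qed
  have oo: "one_one \<rho>"
    unfolding one_one_def single_valued_def \<rho>_def using e by (auto simp: inj_on_def)
  have dom: "Domain \<rho> = A"
  proof -
    have "a \<in> Domain \<rho>" if "a \<in> A" for a
    proof -
      have "e a \<in> e' ` A'" using that im(1) by blast
      then show ?thesis using that by (auto simp: \<rho>_def)
    qed
    then show ?thesis by (auto simp: \<rho>_def)
  qed
  have ran: "Range \<rho> = A'"
    using target[of A A'] im(1) dom by auto
  \<comment> \<open>Membership in \<C> becomes visible in the code: \<open>D\<close> belongs to \<C>
    exactly if its copy is one of the columns of the fifth component.\<close>
  have mem: "D \<in> \<C> \<longleftrightarrow> (\<exists>i\<in>S. e ` D = e ` d i)" if "D \<subseteq> A" for D
  proof -
    have "D \<in> \<C> \<longleftrightarrow> D \<in> d ` S" using that d(1) by auto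
    also have "\<dots> \<longleftrightarrow> (\<exists>i\<in>S. e ` D = e ` d i)"
    proof -
      have "d i \<subseteq> A" if "i \<in> S" for i using d(1) that by auto
      then show ?thesis using inj_on_image_eq_iff[OF e(1) \<open>D \<subseteq> A\<close>] by auto
    qed
    finally show ?thesis .
  qed
  have mem': "E \<in> \<C> \<longleftrightarrow> (\<exists>i\<in>S. e' ` E = e' ` d' i)" if "E \<subseteq> A'" for E
  proof -
    have "E \<in> \<C> \<longleftrightarrow> E \<in> d' ` S" using that d(2) by auto
    also have "\<dots> \<longleftrightarrow> (\<exists>i\<in>S. e' ` E = e' ` d' i)"
    proof -
      have "d' i \<subseteq> A'" if "i \<in> S" for i using d(2) that by auto
      then show ?thesis using inj_on_image_eq_iff[OF e(2) \<open>E \<subseteq> A'\<close>] by auto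
    qed
    finally show ?thesis .
  qed
  have pres: "D \<in> \<C> \<longleftrightarrow> \<rho> `` D \<in> \<C>" if D: "D \<subseteq> A" for D
  proof -
    have "\<rho> `` D \<subseteq> A'" by (auto simp: \<rho>_def)
    then show ?thesis unfolding mem[OF D] mem'[OF \<open>\<rho> `` D \<subseteq> A'\<close>] img[OF D] using dd by simp
  qed
  have ordiff: "(x, x') \<in> \<mu> \<longleftrightarrow> (y, y') \<in> \<mu>" if "(x, y) \<in> \<rho>" "(x', y') \<in> \<rho>" for x y x' y'
  proof -
    from that have *: "x \<in> A" "x' \<in> A" "y \<in> A'" "y' \<in> A'" "e x = e' y" "e x' = e' y'"
      by (auto simp: \<rho>_def)
    have "(x, x') \<in> \<mu> \<longleftrightarrow> (e x, e x') \<in> map_prod e e ` (\<mu> \<inter> A \<times> A)"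
      using inj_on_image_mem_iff[OF map_prod_inj_on[OF e(1) e(1)], of "(x, x')" "\<mu> \<inter> A \<times> A"] * by auto
    also have "\<dots> \<longleftrightarrow> (e' y, e' y') \<in> map_prod e' e' ` (\<mu> \<inter> A' \<times> A')" using ord * by simp
    also have "\<dots> \<longleftrightarrow> (y, y') \<in> \<mu>"
      using inj_on_image_mem_iff[OF map_prod_inj_on[OF e(2) e(2)], of "(y, y')" "\<mu> \<inter> A' \<times> A'"] * by auto
    finally show ?thesis .
  qed
  have "\<rho> \<in> isos \<mu> \<C>"
    unfolding isos_def mem_Collect_eq dom ran using oo sub pres ordiff by blast
  moreover have "\<rho> `` X = X'" "\<rho> `` Y = Y'" using target sub im by simp_all
  ultimately show ?thesis using dom ran by blast
qed

text \<open>This is where \<open>2^\<kappa> = \<kappa>^+\<close> enters: it bounds the number of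
  codes.\<close>

lemma Pow_ordLeq_cardSuc:
  assumes \<kappa>: "Cinfinite \<kappa>" and gch: "ctwo ^c \<kappa> =o cardSuc \<kappa>" and B: "|B| =o \<kappa>"
  shows "|Pow B| \<le>o cardSuc \<kappa>"
proof -
  have "ctwo ^c |B| =o ctwo ^c \<kappa>"
    by (rule cexp_cong2[OF B]) (use \<kappa> in \<open>simp_all add: card_of_Card_order Card_order_ctwo\<close>)
  then have "|Pow B| =o cardSuc \<kappa>"
    using ordIso_transitive[OF Pow_cexp_ctwo ordIso_transitive[OF _ gch]] by blast
  then show ?thesis by (rule ordIso_imp_ordLeq)
qed

lemma ordLeq_obtain_subset:
  assumes \<kappa>: "Card_order \<kappa>" and A: "\<kappa> \<le>o |A|"
  obtains Z where "Z \<subseteq> A" "|Z| =o \<kappa>"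
proof -
  have F: "|Field \<kappa>| =o \<kappa>" using \<kappa> by (rule card_of_Field_ordIso)
  have "|Field \<kappa>| \<le>o |A|" by (rule ordIso_ordLeq_trans[OF F A])
  then obtain Z where "Z \<subseteq> A" "|Field \<kappa>| =o |Z|"
    using internalize_card_of_ordLeq2[of "Field \<kappa>" A] by blast
  then show ?thesis using that ordIso_transitive[OF ordIso_symmetric F] by blast
qed

text \<open>Codes lie in a product of five power sets of sets of size \<kappa>, so at most
  \<open>cardSuc \<kappa>\<close> of them occur. One triple is kept for each code, and triples with
  equal codes are isomorphic.\<close>

lemma task_representatives:
  fixes \<kappa> :: "'k rel" and \<mu> :: "'a rel"
  assumes \<kappa>: "Cinfinite \<kappa>" and gch: "ctwo ^c \<kappa> =o cardSuc \<kappa>"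
    and small: "\<And>C. C \<in> \<C> \<Longrightarrow> |{D \<in> \<C>. D \<subseteq> C}| \<le>o \<kappa>"
    and T: "\<And>A X Y. (A, X, Y) \<in> T \<Longrightarrow> A \<in> \<C> \<and> |A| \<le>o \<kappa> \<and> X \<subseteq> A \<and> Y \<subseteq> A"
  shows "\<exists>R\<subseteq>T. |R| \<le>o cardSuc \<kappa> \<and> (\<forall>A X Y. (A, X, Y) \<in> T \<longrightarrow>
    (\<exists>\<rho>\<in>isos \<mu> \<C>. Domain \<rho> = A \<and> (Range \<rho>, \<rho> `` X, \<rho> `` Y) \<in> R))"
proof -
  let ?S = "Field \<kappa>"
  have S: "|?S| =o \<kappa>" using \<kappa> by (simp add: card_of_Field_ordIso)
  have "\<forall>A\<in>fst ` T. \<exists>e d. inj_on e A \<and> e ` A \<subseteq> ?S \<and> d ` ?S = {D \<in> \<C>. D \<subseteq> A}"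
  proof
    fix A assume "A \<in> fst ` T"
    then have A: "A \<in> \<C>" "|A| \<le>o \<kappa>" using T by auto
    have "|A| \<le>o |?S|" by (rule ordLeq_ordIso_trans[OF A(2) ordIso_symmetric[OF S]])
    then obtain e where "inj_on e A" "e ` A \<subseteq> ?S" using card_of_ordLeq by metis
    moreover have "|{D \<in> \<C>. D \<subseteq> A}| \<le>o |?S|"
      by (rule ordLeq_ordIso_trans[OF small[OF A(1)] ordIso_symmetric[OF S]])
    \<comment> \<open>An enumeration by all of \<open>?S\<close> exists because the family is
      nonempty: it contains \<open>A\<close>.\<close>
    then obtain d where "d ` ?S = {D \<in> \<C>. D \<subseteq> A}"
      using card_of_ordLeq2[of "{D \<in> \<C>. D \<subseteq> A}" ?S] A(1) by blast
    ultimately show "\<exists>e d. inj_on e A \<and> e ` A \<subseteq> ?S \<and> d ` ?S = {D \<in> \<C>. D \<subseteq> A}" by blast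
  qed
  from bchoice[OF this] obtain e where "\<forall>A\<in>fst ` T. \<exists>d. inj_on (e A) A \<and> e A ` A \<subseteq> ?S \<and>
      d ` ?S = {D \<in> \<C>. D \<subseteq> A}" by (elim exE)
  from bchoice[OF this] obtain d where ed: "\<forall>A\<in>fst ` T. inj_on (e A) A \<and> e A ` A \<subseteq> ?S \<and>
      d A ` ?S = {D \<in> \<C>. D \<subseteq> A}" by (elim exE)
  define c where "c t = code \<mu> ?S (e (fst t)) (d (fst t)) t" for t
  define r where "r z = (SOME t. t \<in> T \<and> c t = z)" for z
  have r: "r (c t) \<in> T \<and> c (r (c t)) = c t" if "t \<in> T" for t
    unfolding r_def by (rule someI[of _ t]) (use that in simp)
  define R where "R = r ` c ` T"
  have RT: "R \<subseteq> T" using r unfolding R_def by auto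
  let ?P = "Pow (?S \<times> ?S) \<times> Pow ?S \<times> Pow ?S \<times> Pow ?S \<times> Pow (?S \<times> ?S)"
  have "c ` T \<subseteq> ?P"
  proof
    fix z assume "z \<in> c ` T"
    then obtain A X Y where t: "(A, X, Y) \<in> T" "z = c (A, X, Y)" by auto
    then have "A \<in> fst ` T" by force
    from bspec[OF ed this] have "e A ` A \<subseteq> ?S" "d A ` ?S = {D \<in> \<C>. D \<subseteq> A}" by simp_all
    then have im: "e A ` D \<subseteq> ?S" if "D \<subseteq> A" for D using that by blast
    have "X \<subseteq> A" "Y \<subseteq> A" using T[OF t(1)] by auto
    moreover have "d A i \<subseteq> A" if "i \<in> ?S" for i
      using \<open>d A ` ?S = {D \<in> \<C>. D \<subseteq> A}\<close> that by auto
    then have "(SIGMA i:?S. e A ` d A i) \<subseteq> ?S \<times> ?S" using im by blast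
    moreover have "map_prod (e A) (e A) ` (\<mu> \<inter> A \<times> A) \<subseteq> ?S \<times> ?S"
      using im[of A] by auto
    ultimately show "z \<in> ?P" unfolding t(2) c_def code_def using im[of A] im[of X] im[of Y] by simp
  qed
  note pow = Pow_ordLeq_cardSuc[OF \<kappa> gch]
  have c: "Cinfinite (cardSuc \<kappa>)" using \<kappa> by (rule Cinfinite_cardSuc)
  have SS: "|?S \<times> ?S| =o \<kappa>"
    by (rule ordIso_transitive[OF card_of_Times_same_infinite S]) (use \<kappa> in \<open>simp add: cinfinite_def\<close>)
  have "|?P| \<le>o cardSuc \<kappa>"
    by (intro Times_ordLeq_Cinfinite[OF c] pow S SS)
  then have "|c ` T| \<le>o cardSuc \<kappa>" using \<open>c ` T \<subseteq> ?P\<close> by (rule subset_ordLeq)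
  then have "|R| \<le>o cardSuc \<kappa>" unfolding R_def by (rule image_ordLeq)
  moreover have "\<exists>\<rho>\<in>isos \<mu> \<C>. Domain \<rho> = A \<and> (Range \<rho>, \<rho> `` X, \<rho> `` Y) \<in> R"
    if t: "(A, X, Y) \<in> T" for A X Y
  proof -
    obtain A' X' Y' where t': "r (c (A, X, Y)) = (A', X', Y')" by (cases "r (c (A, X, Y))")
    then have T': "(A', X', Y') \<in> T" and eq: "c (A', X', Y') = c (A, X, Y)" using r[OF t] by auto
    have "A \<in> fst ` T" "A' \<in> fst ` T" using t T' by force+
    then have "\<exists>\<rho>\<in>isos \<mu> \<C>. Domain \<rho> = A \<and> Range \<rho> = A' \<and> \<rho> `` X = X' \<and> \<rho> `` Y = Y'"
      using bspec[OF ed \<open>A \<in> fst ` T\<close>] bspec[OF ed \<open>A' \<in> fst ` T\<close>] T[OF t] T[OF T'] eq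
      by (intro iso_of_code_eq[of "e A" A "e A'" A' "d A" ?S \<C> "d A'"]) (simp_all add: c_def)
    moreover have "(A', X', Y') \<in> R" using t t' unfolding R_def by force
    ultimately show ?thesis by blast
  qed
  ultimately show ?thesis using RT by blast
qed

section \<open>The group\<close>

text \<open>The empty intersection is excluded, as it would be \<open>UNIV\<close> and not a subset
  of a member of \<A>.\<close>

definition finite_Inters :: "'a set set \<Rightarrow> 'a set set" where
  "finite_Inters \<A> = {\<Inter>F | F. finite F \<and> F \<noteq> {} \<and> F \<subseteq> \<A>}"

lemma finite_Inters_incl: "A \<in> \<A> \<Longrightarrow> A \<in> finite_Inters \<A>"
  unfolding finite_Inters_def by (intro CollectI exI[of _ "{A}"]) simp

lemma finite_Inters_Int: "\<forall>C\<in>finite_Inters \<A>. \<forall>D\<in>finite_Inters \<A>. C \<inter> D \<in> finite_Inters \<A>"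
proof (intro ballI)
  fix C D assume "C \<in> finite_Inters \<A>" "D \<in> finite_Inters \<A>"
  then obtain F G where "finite F" "F \<noteq> {}" "F \<subseteq> \<A>" "C = \<Inter>F" "finite G" "G \<subseteq> \<A>" "D = \<Inter>G"
    unfolding finite_Inters_def by blast
  then show "C \<inter> D \<in> finite_Inters \<A>"
    unfolding finite_Inters_def by (intro CollectI exI[of _ "F \<union> G"]) auto
qed

text \<open>With \<open>C\<close> inside some \<open>A\<close> of \<A>, each \<open>D\<close> below
  \<open>C\<close> is a finite intersection of traces on \<open>A\<close>; local smallness allows at
  most \<kappa> traces, hence at most \<kappa> finite sets of them.\<close>

lemma card_finite_Inters_below:
  assumes \<kappa>: "Cinfinite \<kappa>" and ls: "locally_small \<kappa> \<A>" and C: "C \<in> finite_Inters \<A>"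
  shows "|{D \<in> finite_Inters \<A>. D \<subseteq> C}| \<le>o \<kappa>"
proof -
  from C obtain A where A: "A \<in> \<A>" "C \<subseteq> A" unfolding finite_Inters_def by blast
  let ?R = "{B \<inter> A | B. B \<in> \<A>}"
  have "{D \<in> finite_Inters \<A>. D \<subseteq> C} \<subseteq> Inter ` Fpow ?R"
  proof
    fix D assume "D \<in> {D \<in> finite_Inters \<A>. D \<subseteq> C}"
    then obtain F where F: "finite F" "F \<noteq> {}" "F \<subseteq> \<A>" "D = \<Inter>F" "D \<subseteq> C"
      unfolding finite_Inters_def by blast
    have "D = \<Inter>((\<lambda>B. B \<inter> A) ` F)" using F(2,4,5) A(2) by auto
    moreover have "(\<lambda>B. B \<inter> A) ` F \<in> Fpow ?R" using F(1,3) unfolding Fpow_def by auto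
    ultimately show "D \<in> Inter ` Fpow ?R" by (rule image_eqI)
  qed
  moreover have "|Inter ` Fpow ?R| \<le>o \<kappa>"
    by (rule image_ordLeq[OF Fpow_ordLeq_Cinfinite[OF \<kappa>]]) (use ls A(1) in \<open>simp add: locally_small_def\<close>)
  ultimately show ?thesis using subset_ordLeq by blast
qed

text \<open>The letters and the length are uniform in \<open>x\<close>, so one pair
  \<open>L\<close>, \<open>n\<close> controls a whole group element; this is what
  \<open>evades\<close> can contradict.\<close>

definition path_group :: "'a set \<Rightarrow> 'a rel set \<Rightarrow> ('a \<Rightarrow> 'a) set" where
  "path_group S N = {g \<in> Bij S. \<exists>L n. finite L \<and> L \<subseteq> N \<and> (\<forall>x\<in>S. (x, g x) \<in> edges L ^^ n)}"

text \<open>Composition unites the finite letter sets and adds the lengths; an inverse walks the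
  same paths backwards.\<close>

lemma permutation_group_path_group: "permutation_group S (path_group S N)"
  unfolding permutation_group_def
proof (rule subgroup.intro)
  show "path_group S N \<subseteq> carrier (BijGroup S)"
    unfolding path_group_def BijGroup_def by auto
next
  fix g f assume g: "g \<in> path_group S N" and f: "f \<in> path_group S N"
  then have bij: "g \<in> Bij S" "f \<in> Bij S" by (auto simp: path_group_def)
  obtain L n where L: "finite L" "L \<subseteq> N" "\<forall>x\<in>S. (x, g x) \<in> edges L ^^ n"
    using g unfolding path_group_def by blast
  obtain M m where M: "finite M" "M \<subseteq> N" "\<forall>x\<in>S. (x, f x) \<in> edges M ^^ m"
    using f unfolding path_group_def by blast
  have "(x, compose S g f x) \<in> edges (L \<union> M) ^^ (m + n)" if x: "x \<in> S" for x
  proof -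
    have fx: "f x \<in> S" using bij(2) x by (auto simp: Bij_def bij_betw_def)
    have "(x, f x) \<in> edges (L \<union> M) ^^ m"
      using M(3) x edges_relpow_mono[of M "L \<union> M" m m] by auto
    moreover have "(f x, g (f x)) \<in> edges (L \<union> M) ^^ n"
      using L(3) fx edges_relpow_mono[of L "L \<union> M" n n] by auto
    ultimately show ?thesis using x by (auto simp: compose_def relpow_add)
  qed
  moreover have "finite (L \<union> M)" "L \<union> M \<subseteq> N" using L(1,2) M(1,2) by auto
  ultimately have "compose S g f \<in> path_group S N"
    unfolding path_group_def using compose_Bij[OF bij] by blast
  then show "g \<otimes>\<^bsub>BijGroup S\<^esub> f \<in> path_group S N"
    using bij by (simp add: BijGroup_def)
next
  have "\<forall>x\<in>S. (x, (\<lambda>x\<in>S. x) x) \<in> edges {} ^^ 0" by simp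
  then have "(\<lambda>x\<in>S. x) \<in> path_group S N"
    unfolding path_group_def using id_Bij by (intro CollectI conjI exI[of _ "{}"] exI[of _ 0]) simp_all
  then show "\<one>\<^bsub>BijGroup S\<^esub> \<in> path_group S N" by (simp add: BijGroup_def)
next
  fix g assume g: "g \<in> path_group S N"
  then have bij: "g \<in> Bij S" by (auto simp: path_group_def)
  obtain L n where L: "finite L" "L \<subseteq> N" "\<forall>x\<in>S. (x, g x) \<in> edges L ^^ n"
    using g unfolding path_group_def by blast
  have "(x, (\<lambda>x\<in>S. inv_into S g x) x) \<in> edges L ^^ n" if x: "x \<in> S" for x
  proof -
    have "x \<in> g ` S" using bij x by (auto simp: Bij_def bij_betw_def)
    then have "inv_into S g x \<in> S" "g (inv_into S g x) = x"
      by (auto simp: inv_into_into f_inv_into_f)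
    then have "(inv_into S g x, x) \<in> edges L ^^ n" using L(3) by force
    then show ?thesis using x sym_relpow[OF sym_edges] by auto
  qed
  then have "(\<lambda>x\<in>S. inv_into S g x) \<in> path_group S N"
    unfolding path_group_def using L(1,2) restrict_inv_into_Bij[OF bij] by blast
  then show "inv\<^bsub>BijGroup S\<^esub> g \<in> path_group S N" using inv_BijGroup[OF bij] by simp
qed

lemma one_one_extends_to_Bij:
  assumes k: "one_one k" "Domain k = A" "Range k = A" and A: "A \<subseteq> S"
  shows "\<exists>g\<in>Bij S. (\<forall>x\<in>S. (x, g x) \<in> Id \<union> k) \<and> (\<forall>X\<subseteq>A. g ` X = k `` X)"
proof -
  \<comment> \<open>The permutation is extended by the identity; \<open>restrict\<close> makes it
    \<open>undefined\<close> outside \<open>S\<close>, as \<open>Bij\<close> demands.\<close>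
  define g where "g = (\<lambda>x\<in>S. if x \<in> A then THE y. (x, y) \<in> k else x)"
  have gk: "g x = y" if "(x, y) \<in> k" for x y
  proof -
    have "x \<in> A" using that k(2) by blast
    moreover have "(THE y. (x, y) \<in> k) = y" using that one_oneD(1)[OF k(1)] by blast
    ultimately show ?thesis using A by (auto simp: g_def)
  qed
  have gA: "(x, g x) \<in> k" if "x \<in> A" for x
  proof -
    from that k(2) obtain y where "(x, y) \<in> k" by blast
    then show ?thesis using gk by simp
  qed
  have gid: "g x = x" if "x \<in> S - A" for x using that by (simp add: g_def)
  have inS: "g x \<in> A \<longleftrightarrow> x \<in> A" "g x \<in> S" if "x \<in> S" for x
    using gA[of x] gid[of x] that k(3) A by (cases "x \<in> A"; auto)+
  have "bij_betw g S S"
    unfolding bij_betw_def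
  proof
    show "inj_on g S"
    proof (rule inj_onI)
      fix x y assume xy: "x \<in> S" "y \<in> S" "g x = g y"
      show "x = y"
      proof (cases "x \<in> A")
        case True
        then have "y \<in> A" using inS xy by metis
        then show ?thesis using gA[OF True] gA[of y] xy(3) one_oneD(2)[OF k(1)] by metis
      next
        case False
        then have "y \<notin> A" using inS xy by metis
        then have "g x = x" "g y = y" using gid False xy(1,2) by blast+
        then show ?thesis using xy(3) by metis
      qed
    qed
    show "g ` S = S"
    proof (intro equalityI subsetI)
      fix y assume y: "y \<in> S"
      show "y \<in> g ` S"
      proof (cases "y \<in> A")
        case True
        then obtain x where "(x, y) \<in> k" using k(3) by blast
        moreover from this have "x \<in> S" using k(2) A by blast
        ultimately show ?thesis using gk by blast
      next
        case False
        then show ?thesis using gid[of y] y by (intro image_eqI[of _ _ y]) simp_all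
      qed
    qed (use inS in blast)
  qed
  moreover have "g \<in> extensional S" by (simp add: g_def)
  ultimately have "g \<in> Bij S" by (simp add: Bij_def)
  moreover have "(x, g x) \<in> Id \<union> k" if "x \<in> S" for x
    using gA[of x] gid[of x] that by (cases "x \<in> A") simp_all
  moreover have "g ` X = k `` X" if "X \<subseteq> A" for X
  proof (intro equalityI subsetI)
    fix y assume "y \<in> k `` X"
    then obtain x where "x \<in> X" "(x, y) \<in> k" by blast
    then show "y \<in> g ` X" using gk by blast
  qed (use gA that in blast)
  ultimately show ?thesis by blast
qed

text \<open>The counterexample is \<Phi> read as a map. A group element extending it would put all
  of \<Phi> into a single \<open>edges L ^^ n\<close>, while \<kappa> many pairs evade that
  relation.\<close>

lemma not_transitive_path_group:
  assumes \<kappa>: "Cinfinite \<kappa>" and \<mu>: "Cinfinite \<mu>" "\<kappa> <o \<mu>" and \<Phi>: "one_one \<Phi>" "\<Phi> \<subseteq> K \<times> K"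
    and K: "K \<subseteq> Field \<mu>" "|K| \<le>o \<kappa>" and ev: "evades \<kappa> \<Phi> N"
  shows "\<not> transitive \<kappa> (Field \<mu>) (path_group (Field \<mu>) N)"
proof
  assume tr: "transitive \<kappa> (Field \<mu>) (path_group (Field \<mu>) N)"
  define f where "f x = (if x \<in> Domain \<Phi> then Some (THE y. (x, y) \<in> \<Phi>) else None)" for x
  have f: "f x = Some y \<longleftrightarrow> (x, y) \<in> \<Phi>" for x y
  proof
    assume xy: "(x, y) \<in> \<Phi>"
    then have "(THE y. (x, y) \<in> \<Phi>) = y" using one_oneD(1)[OF \<Phi>(1)] by blast
    then show "f x = Some y" using xy by (auto simp: f_def)
  next
    assume xy: "f x = Some y"
    then have "x \<in> Domain \<Phi>" "y = (THE y. (x, y) \<in> \<Phi>)" by (auto simp: f_def split: if_splits)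
    then obtain z where z: "(x, z) \<in> \<Phi>" by blast
    then have "(THE y. (x, y) \<in> \<Phi>) = z" using one_oneD(1)[OF \<Phi>(1)] by blast
    then show "(x, y) \<in> \<Phi>" using z \<open>y = _\<close> by simp
  qed
  have dom: "dom f = Domain \<Phi>" using f by (auto simp: dom_def)
  have ran: "ran f = Range \<Phi>" using f by (auto simp: ran_def)
  have inj: "inj_on f (dom f)"
  proof (rule inj_onI)
    fix x y assume "x \<in> dom f" "y \<in> dom f" "f x = f y"
    then obtain z where "(x, z) \<in> \<Phi>" "(y, z) \<in> \<Phi>" using f by (metis domD)
    then show "x = y" by (rule one_oneD(2)[OF \<Phi>(1)])
  qed
  \<comment> \<open>Removing at most \<kappa> points, with \<open>\<kappa> <o \<mu>\<close>, leaves
    a set of full size.\<close>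
  have big: "|Field \<mu> - D| =o |Field \<mu>|" if "D \<subseteq> K" for D
  proof -
    have F: "|Field \<mu>| =o \<mu>" using \<mu>(1) by (simp add: card_of_Field_ordIso)
    have "|D| <o \<mu>" using subset_ordLeq[OF K(2) that] \<mu>(2) ordLeq_ordLess_trans by blast
    then have "\<mu> \<le>o |Field \<mu> - D|"
      using ordLeq_Diff_ordLess[OF \<mu>(1) ordIso_imp_ordLeq[OF ordIso_symmetric[OF F]]] by blast
    then have "|Field \<mu>| \<le>o |Field \<mu> - D|" using F ordIso_ordLeq_trans by blast
    moreover have "|Field \<mu> - D| \<le>o |Field \<mu>|" by (rule card_of_mono1) auto
    ultimately show ?thesis by (simp add: ordIso_iff_ordLeq)
  qed
  have sub: "dom f \<subseteq> K" "ran f \<subseteq> K" using \<Phi>(2) unfolding dom ran by auto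
  then have "dom f \<union> ran f \<in> subsets_of_card_le (Field \<mu>) \<kappa>"
    unfolding subsets_of_card_le_def using subset_ordLeq[OF K(2), of "dom f \<union> ran f"] K(1) by auto
  then obtain g where g: "g \<in> path_group (Field \<mu>) N" "Map.graph f \<subseteq> (\<lambda>x. (x, g x)) ` Field \<mu>"
    using tr inj big[OF sub(1)] big[OF sub(2)] unfolding transitive_def by blast
  obtain L n where L: "finite L" "L \<subseteq> N" "\<forall>x\<in>Field \<mu>. (x, g x) \<in> edges L ^^ n"
    using g(1) unfolding path_group_def by blast
  have "\<Phi> \<subseteq> edges L ^^ n"
  proof (rule subrelI)
    fix x y assume "(x, y) \<in> \<Phi>"
    then have "(x, y) \<in> Map.graph f" using f by (simp add: Map.graph_def)
    then show "(x, y) \<in> edges L ^^ n" using g(2) L(3) by auto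
  qed
  then have "finite (\<Phi> - edges L ^^ n)" by (simp add: Diff_eq_empty_iff[THEN iffD2])
  then have "|\<Phi> - edges L ^^ n| <o \<kappa>" by (rule finite_ordLess_Cinfinite[OF _ \<kappa>])
  moreover have "\<kappa> \<le>o |\<Phi> - edges L ^^ n|" using ev L(1,2) unfolding evades_def by blast
  ultimately show False using not_ordLess_ordLeq by blast
qed

text \<open>Cover \<open>X\<close> and \<open>Y\<close> by a member \<open>A\<close> of \<A>, carry
  the triple to its representative by \<rho>, apply the permutation \<open>h\<close> realizing it,
  and return along the converse of \<rho>.\<close>

lemma homogeneous_path_group:
  assumes \<kappa>: "Cinfinite \<kappa>" and \<mu>: "Cinfinite \<mu>" "\<kappa> <o \<mu>" and cof: "cofinal_family \<kappa> (Field \<mu>) \<A>"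
    and real: "\<And>A X Y. A \<in> \<A> \<Longrightarrow> X \<in> subsets_of_card A \<kappa> \<Longrightarrow> Y \<in> subsets_of_card A \<kappa> \<Longrightarrow>
      \<kappa> \<le>o |A - X| \<Longrightarrow> \<kappa> \<le>o |A - Y| \<Longrightarrow>
      \<exists>\<rho>\<in>N. \<exists>h\<in>N. one_one \<rho> \<and> Domain \<rho> = A \<and> realizes h (Range \<rho>, \<rho> `` X, \<rho> `` Y)"
  shows "homogeneous \<kappa> (Field \<mu>) (path_group (Field \<mu>) N)"
  unfolding homogeneous_def
proof (intro ballI impI)
  fix X Y assume XY: "X \<in> subsets_of_card (Field \<mu>) \<kappa>" "Y \<in> subsets_of_card (Field \<mu>) \<kappa>"
  then have X: "X \<subseteq> Field \<mu>" "|X| =o \<kappa>" and Y: "Y \<subseteq> Field \<mu>" "|Y| =o \<kappa>"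
    by (auto simp: subsets_of_card_def)
  have U\<kappa>: "|X \<union> Y| \<le>o \<kappa>" by (intro Un_ordLeq_Cinfinite[OF \<kappa>] ordIso_imp_ordLeq X Y)
  have F: "|Field \<mu>| =o \<mu>" using \<mu>(1) by (simp add: card_of_Field_ordIso)
  have "\<mu> \<le>o |Field \<mu> - (X \<union> Y)|"
    by (rule ordLeq_Diff_ordLess[OF \<mu>(1) ordIso_imp_ordLeq[OF ordIso_symmetric[OF F]]
          ordLeq_ordLess_trans[OF U\<kappa> \<mu>(2)]])
  then have "\<kappa> \<le>o |Field \<mu> - (X \<union> Y)|" by (rule ordLeq_transitive[OF ordLess_imp_ordLeq[OF \<mu>(2)]])
  \<comment> \<open>\<open>Z\<close> is a reserve of \<kappa> points off \<open>X\<close> and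
    \<open>Y\<close>; covering it as well makes both complements inside \<open>A\<close> have size
    at least \<kappa>.\<close>
  then obtain Z where Z: "Z \<subseteq> Field \<mu> - (X \<union> Y)" and "|Z| =o \<kappa>"
    using ordLeq_obtain_subset \<kappa> by metis
  then have Z\<kappa>: "|Z| \<le>o \<kappa>" "\<kappa> \<le>o |Z|" by (simp_all add: ordIso_iff_ordLeq)
  let ?B = "X \<union> Y \<union> Z"
  have "|?B| \<le>o \<kappa>" by (intro Un_ordLeq_Cinfinite[OF \<kappa> U\<kappa>] Z\<kappa>(1))
  moreover have "\<kappa> \<le>o |?B|"
    by (rule ordLeq_transitive[OF Z\<kappa>(2) card_of_mono1]) auto
  ultimately have "?B \<in> subsets_of_card (Field \<mu>) \<kappa>"
    using X(1) Y(1) Z by (auto simp: subsets_of_card_def ordIso_iff_ordLeq)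
  then obtain A where A: "A \<in> \<A>" "?B \<subseteq> A" using cof unfolding cofinal_family_def by blast
  have AF: "A \<subseteq> Field \<mu>" using A(1) cof unfolding cofinal_family_def subsets_of_card_def by blast
  have AXY: "\<kappa> \<le>o |A - X|" "\<kappa> \<le>o |A - Y|"
    by (rule ordLeq_transitive[OF Z\<kappa>(2) card_of_mono1], use Z A(2) in blast)+
  have XYA: "X \<in> subsets_of_card A \<kappa>" "Y \<in> subsets_of_card A \<kappa>"
    using X(2) Y(2) A(2) by (auto simp: subsets_of_card_def)
  obtain \<rho> h where \<rho>: "\<rho> \<in> N" "one_one \<rho>" "Domain \<rho> = A"
    and h: "h \<in> N" "realizes h (Range \<rho>, \<rho> `` X, \<rho> `` Y)"
    using real[OF A(1) XYA AXY] by (elim bexE conjE)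
  from h(2) have h': "one_one h" "Domain h = Range \<rho>" "Range h = Range \<rho>" "h `` (\<rho> `` X) = \<rho> `` Y"
    by (auto simp: realizes_def)
  let ?k = "\<rho> O h O \<rho>\<inverse>"
  have k1: "one_one ?k" by (intro one_one_relcomp one_one_converse \<rho>(2) h'(1))
  have k2: "Domain ?k = A" "Range ?k = A" using \<rho>(3) h'(2,3) by blast+
  obtain g where g: "g \<in> Bij (Field \<mu>)" "\<forall>x\<in>Field \<mu>. (x, g x) \<in> Id \<union> ?k" "\<forall>X\<subseteq>A. g ` X = ?k `` X"
    using one_one_extends_to_Bij[OF k1 k2 AF] by (elim bexE conjE)
  have "?k `` X = \<rho>\<inverse> `` (\<rho> `` Y)" using h'(4) by (simp add: relcomp_Image)
  also have "\<dots> = Y"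
  proof -
    have "Y \<subseteq> Range (\<rho>\<inverse>)" using \<rho>(3) A(2) by auto
    then show ?thesis using one_one_Image_converse[OF one_one_converse[OF \<rho>(2)]] by simp
  qed
  finally have "g ` X = Y" using g(3) A(2) by auto
  \<comment> \<open>The conjugate takes three steps; the points outside \<open>A\<close> are fixed,
    which \<open>Id\<close> accounts for.\<close>
  moreover have "(x, g x) \<in> edges {\<rho>, h} ^^ 3" if "x \<in> Field \<mu>" for x
  proof -
    have "\<rho> \<union> h \<union> \<rho>\<inverse> \<subseteq> edges {\<rho>, h}" by (auto simp: edges_def)
    then have "?k \<subseteq> edges {\<rho>, h} O edges {\<rho>, h} O edges {\<rho>, h}" by blast
    also have "\<dots> = edges {\<rho>, h} ^^ 3" by (simp add: numeral_3_eq_3 O_assoc)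
    finally have "Id \<union> ?k \<subseteq> edges {\<rho>, h} ^^ 3"
      using edges_relpow_mono[of "{\<rho>, h}" "{\<rho>, h}" 0 3] by auto
    then show ?thesis using g(2) that by blast
  qed
  then have "g \<in> path_group (Field \<mu>) N"
    unfolding path_group_def using g(1) \<rho>(1) h(1)
    by (intro CollectI conjI exI[of _ "{\<rho>, h}"] exI[of _ 3]) auto
  ultimately show "\<exists>g\<in>path_group (Field \<mu>) N. g ` X = Y" by blast
qed

theorem theorem3p4:
  fixes \<kappa> :: "'k rel" and \<mu> :: "'a rel"
  assumes "Cinfinite \<kappa>" and "Cinfinite \<mu>" and "\<kappa> <o \<mu>"
    and "ctwo ^c \<kappa> =o cardSuc \<kappa>"
    and "\<exists>\<A>. cofinal_family \<kappa> (Field \<mu>) \<A> \<and> locally_small \<kappa> \<A>"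
  shows "\<exists>G. permutation_group (Field \<mu>) G \<and>
             homogeneous \<kappa> (Field \<mu>) G \<and> \<not> transitive \<kappa> (Field \<mu>) G"
proof -
  note \<kappa> = assms(1) and \<mu> = assms(2,3)
  obtain \<A> where cof: "cofinal_family \<kappa> (Field \<mu>) \<A>" and ls: "locally_small \<kappa> \<A>"
    using assms(5) by blast
  let ?\<C> = "finite_Inters \<A>"
  have wo: "Well_order \<mu>" using \<mu>(1) by (simp add: card_order_on_well_order_on)
  have mem: "A \<subseteq> Field \<mu>" "|A| =o \<kappa>" if "A \<in> \<A>" for A
    using that cof unfolding cofinal_family_def subsets_of_card_def by blast+
  have fld: "C \<subseteq> Field \<mu>" if "C \<in> ?\<C>" for C
    using that mem(1) unfolding finite_Inters_def by blast
  note small = card_finite_Inters_below[OF \<kappa> ls]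
  \<comment> \<open>The carrier of \<Phi> can be any member of \<A>; cofinality provides one, above
    some subset of size \<kappa>.\<close>
  obtain K where K: "K \<in> \<A>"
  proof -
    have F: "|Field \<mu>| =o \<mu>" using \<mu>(1) by (simp add: card_of_Field_ordIso)
    have "\<kappa> \<le>o |Field \<mu>|"
      by (rule ordLeq_ordIso_trans[OF ordLess_imp_ordLeq[OF \<mu>(2)] ordIso_symmetric[OF F]])
    then obtain Z where "Z \<subseteq> Field \<mu>" "|Z| =o \<kappa>"
      using ordLeq_obtain_subset \<kappa> by metis
    then have "Z \<in> subsets_of_card (Field \<mu>) \<kappa>"
      by (simp add: subsets_of_card_def)
    then show ?thesis using cof that unfolding cofinal_family_def by blast
  qed
  define T where "T = {(A, X, Y). A \<in> \<A> \<and> X \<in> subsets_of_card A \<kappa> \<and> Y \<in> subsets_of_card A \<kappa> \<and>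
      \<kappa> \<le>o |A - X| \<and> \<kappa> \<le>o |A - Y|}"
  have T: "A \<in> ?\<C> \<and> |A| \<le>o \<kappa> \<and> X \<subseteq> A \<and> Y \<subseteq> A \<and> \<kappa> \<le>o |X| \<and> \<kappa> \<le>o |Y| \<and>
      \<kappa> \<le>o |A - X| \<and> \<kappa> \<le>o |A - Y|" if "(A, X, Y) \<in> T" for A X Y
    using that mem(2)[of A] finite_Inters_incl[of A \<A>]
    by (auto simp: T_def subsets_of_card_def ordIso_iff_ordLeq)
  have "\<exists>R\<subseteq>T. |R| \<le>o cardSuc \<kappa> \<and> (\<forall>A X Y. (A, X, Y) \<in> T \<longrightarrow>
      (\<exists>\<rho>\<in>isos \<mu> ?\<C>. Domain \<rho> = A \<and> (Range \<rho>, \<rho> `` X, \<rho> `` Y) \<in> R))"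
    by (rule task_representatives[OF \<kappa> assms(4) small]) (use T in auto)
  then obtain R where R: "R \<subseteq> T" "|R| \<le>o cardSuc \<kappa>"
    and rep: "\<forall>A X Y. (A, X, Y) \<in> T \<longrightarrow>
      (\<exists>\<rho>\<in>isos \<mu> ?\<C>. Domain \<rho> = A \<and> (Range \<rho>, \<rho> `` X, \<rho> `` Y) \<in> R)"
    by (elim exE conjE)
  have KC: "K \<in> ?\<C>" "\<kappa> \<le>o |K|"
    using finite_Inters_incl[OF K] ordIso_imp_ordLeq[OF ordIso_symmetric[OF mem(2)[OF K]]] .
  have "\<exists>\<Phi> h. one_one \<Phi> \<and> \<Phi> \<subseteq> K \<times> K \<and> (\<forall>t\<in>R. realizes (h t) t) \<and>
      evades \<kappa> \<Phi> (isos \<mu> ?\<C> \<union> h ` R)"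
    by (rule generic_permutations[OF \<kappa> wo finite_Inters_Int fld small KC R(2) T[OF subsetD[OF R(1)]]])
  then obtain \<Phi> h where \<Phi>: "one_one \<Phi>" "\<Phi> \<subseteq> K \<times> K" and h: "\<forall>t\<in>R. realizes (h t) t"
    and ev: "evades \<kappa> \<Phi> (isos \<mu> ?\<C> \<union> h ` R)"
    by (elim exE conjE)
  let ?N = "isos \<mu> ?\<C> \<union> h ` R"
  have "homogeneous \<kappa> (Field \<mu>) (path_group (Field \<mu>) ?N)"
  proof (rule homogeneous_path_group[OF \<kappa> \<mu> cof])
    fix A X Y assume "A \<in> \<A>" "X \<in> subsets_of_card A \<kappa>" "Y \<in> subsets_of_card A \<kappa>"
      "\<kappa> \<le>o |A - X|" "\<kappa> \<le>o |A - Y|"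
    then have "(A, X, Y) \<in> T" by (simp add: T_def)
    with rep obtain \<rho> where \<rho>: "\<rho> \<in> isos \<mu> ?\<C>" "Domain \<rho> = A" "(Range \<rho>, \<rho> `` X, \<rho> `` Y) \<in> R"
      by blast
    \<comment> \<open>Both letters of the conjugation are at hand: the isomorphism to the
      representative and the permutation chosen for it.\<close>
    show "\<exists>\<rho>\<in>?N. \<exists>k\<in>?N. one_one \<rho> \<and> Domain \<rho> = A \<and> realizes k (Range \<rho>, \<rho> `` X, \<rho> `` Y)"
      by (rule bexI[of _ \<rho>], rule bexI[of _ "h (Range \<rho>, \<rho> `` X, \<rho> `` Y)"])
        (use \<rho> h isosD(1)[OF \<rho>(1)] in simp_all)
  qed
  moreover have "\<not> transitive \<kappa> (Field \<mu>) (path_group (Field \<mu>) ?N)"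
    by (rule not_transitive_path_group[OF \<kappa> \<mu> \<Phi> mem(1)[OF K] ordIso_imp_ordLeq[OF mem(2)[OF K]] ev])
  ultimately show ?thesis using permutation_group_path_group by blast
qed

end
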